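(* Let $I=[0,1]$, let $\{I_i\}_i$ be a finite partition of $I$ (up to finitely many points) by open intervals, and let $T\colon \bigcup_i I_i\to I$. Suppose that: - the Lebesgue measure $m$ on $I$ is $T$-invariant; - for some $r>0$, $T$ is piecewise $C^{r+1}$ and expanding, Markovian with $k$ branches, all of them onto, and $$\exp\big(P_{top}(-(r+1)\log|DT|)\big)<\frac1k;$$ - the transfer operator $L$ associated with $T$, with respect to $m$, preserves a Banach space of functions $B$ that is continuously embedded in $L^1(I)$, and the operator $L\colon B\to B$ is bounded; - there is $C\ge0$ such that for every interval $J\subset I$ we have $1_J\in B$ and $\|1_J\|_B\le C$. Then $$r_{ess}(L,B)\ \ge\ \frac1k.$$
   Context: Functions are complex-valued and identified when equal $m$-a.e.; intervals may be open, closed or half-open. Piecewise $C^{r+1}$, with $k$ branches all onto: there are $k$ intervals $I_i$, and each $T|_{I_i}$ extends to a $C^{r+1}$ diffeomorphism from $\overline{I_i}$ onto $I$. Expanding: there is $\lambda_0>1$ with $|DT(x)|\ge\lambda_0$ for all $x\in\bigcup_i I_i$. Topological pressure: with $\mathcal{P}^n$ the collection of intervals of monotonicity (branches) of $T^n$, for a potential $\phi$ (here $\phi=-(r+1)\log|DT|$), $P_{top}(\phi)=\lim_{n\to\infty}\frac1n\log\sum_{P\in\mathcal{P}^n}\sup_{x\in P}\exp\big(\sum_{j=0}^{n-1}\phi(T^jx)\big)$. Transfer operator: $L\colon L^1(I)\to L^1(I)$, $(L\phi)(x)=\sum_{T(y)=x}\phi(y)/|DT(y)|$; equivalently $\int \psi\,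 L\phi\,dm=\int (\psi\circ T)\,\phi\,dm$ for all $\psi\in L^\infty(I)$, $\phi\in L^1(I)$. A Banach space of functions continuously embedded in $L^1(I)$ is a complex linear subspace $B\subset L^1(I)$ with a complete norm $\|\cdot\|_B$ such that the inclusion into $L^1(I)$ is bounded. "$L$ preserves $B$" means $L(B)\subset B$. Essential spectral radius: $r_{ess}(L,B)$ is the infimum of the $r'\ge0$ such that every point of the spectrum of $L\colon B\to B$ with modulus $>r'$ is an isolated eigenvalue of finite algebraic multiplicity. *)

theory Defs
  imports "HOL-Analysis.Analysis"
begin

class complex_banach = banach +
  fixes scaleC :: "complex \<Rightarrow> 'a \<Rightarrow> 'a"  (infixr "*\<^sub>C" 75)
  assumes scaleC_add_right: "a *\<^sub>C (x + y) = a *\<^sub>C x + a *\<^sub>C y"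
    and scaleC_add_left: "(a + b) *\<^sub>C x = a *\<^sub>C x + b *\<^sub>C x"
    and scaleC_scaleC: "a *\<^sub>C b *\<^sub>C x = (a * b) *\<^sub>C x"
    and scaleC_of_real: "complex_of_real t *\<^sub>C x = t *\<^sub>R x"
    and norm_scaleC: "norm (a *\<^sub>C x) = cmod a * norm x"

definition spectrum :: "('b::complex_banach \<Rightarrow> 'b) \<Rightarrow> complex set" where
  "spectrum A = {z. \<not> (\<exists>R. bounded_linear R \<and>
     (\<forall>f. R (z *\<^sub>C f - A f) = f) \<and> (\<forall>f. z *\<^sub>C R f - A (R f) = f))}"

definition resolvent :: "('b::complex_banach \<Rightarrow> 'b) \<Rightarrow> complex \<Rightarrow> 'b \<Rightarrow> 'b" where
  "resolvent A z = inv (\<lambda>f. z *\<^sub>C f - A f)"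

(* The contour integral of the resolvent over the circle of radius e around z,
   parametrised by z + e * cis t and divided by 2 * pi * \<i>. *)
definition riesz_projection ::
    "('b::complex_banach \<Rightarrow> 'b) \<Rightarrow> complex \<Rightarrow> real \<Rightarrow> 'b \<Rightarrow> 'b" where
  "riesz_projection A z e f =
     (1 / (2 * complex_of_real pi * \<i>)) *\<^sub>C
       integral {0..2 * pi}
         (\<lambda>t. (\<i> * complex_of_real e * cis t) *\<^sub>C resolvent A (z + complex_of_real e * cis t) f)"

(* The algebraic multiplicity of an isolated point of the spectrum is the rank of its
   Riesz projection. This can exceed the dimension of the generalised eigenspace
   (the union of the kernels of the powers of A - z), which is not enough here. *)
definition isolated_eigenvalue_of_finite_multiplicity ::
    "('b::complex_banach \<Rightarrow> 'b) \<Rightarrow> complex \<Rightarrow> bool" where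
  "isolated_eigenvalue_of_finite_multiplicity A z \<longleftrightarrow>
     (\<exists>f. f \<noteq> 0 \<and> A f = z *\<^sub>C f) \<and>
     (\<exists>e>0. spectrum A \<inter> cball z e = {z} \<and>
        (\<exists>F. finite F \<and>
          (\<forall>f. \<exists>c. riesz_projection A z e f = (\<Sum>g\<in>F. c g *\<^sub>C g))))"

definition ess_spectral_radius :: "('b::complex_banach \<Rightarrow> 'b) \<Rightarrow> real" where
  "ess_spectral_radius A =
     Inf {\<rho>. 0 \<le> \<rho> \<and>
       (\<forall>z\<in>spectrum A. cmod z > \<rho> \<longrightarrow> isolated_eigenvalue_of_finite_multiplicity A z)}"

(* An element of L^1([0,1]) is represented by an integrable function, two of them being
   identified when equal almost everywhere. A Banach space of functions is a Banach space
   'b with a map that sends f to a representative of the class of f. The map is linear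
   and injective on classes, so that 'b is a subspace of L^1([0,1]) with its own norm. *)
definition continuously_embedded_L1 :: "('b::complex_banach \<Rightarrow> real \<Rightarrow> complex) \<Rightarrow> bool" where
  "continuously_embedded_L1 \<iota> \<longleftrightarrow>
     (\<forall>f. integrable (lebesgue_on {0..1}) (\<iota> f)) \<and>
     (\<forall>f g. AE x in lebesgue_on {0..1}. \<iota> (f + g) x = \<iota> f x + \<iota> g x) \<and>
     (\<forall>c f. AE x in lebesgue_on {0..1}. \<iota> (c *\<^sub>C f) x = c * \<iota> f x) \<and>
     (\<forall>f. (AE x in lebesgue_on {0..1}. \<iota> f x = 0) \<longrightarrow> f = 0) \<and>
     (\<exists>K. \<forall>f. (LINT x|lebesgue_on {0..1}. cmod (\<iota> f x)) \<le> K * norm f)"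

(* C^s for real s: with n = floor s, the n-th derivative (one-sided at endpoints) exists, is
   continuous and, if s is not an integer, is Hoelder with exponent s - n. *)
definition C_class :: "real \<Rightarrow> real set \<Rightarrow> (real \<Rightarrow> real) \<Rightarrow> bool" where
  "C_class s S f \<longleftrightarrow>
     (\<exists>D :: nat \<Rightarrow> real \<Rightarrow> real.
        (\<forall>x\<in>S. D 0 x = f x) \<and>
        (\<forall>j<nat \<lfloor>s\<rfloor>. \<forall>x\<in>S. (D j has_real_derivative D (Suc j) x) (at x within S)) \<and>
        continuous_on S (D (nat \<lfloor>s\<rfloor>)) \<and>
        (s \<notin> \<int> \<longrightarrow>
          (\<exists>H. \<forall>x\<in>S. \<forall>y\<in>S.
             \<bar>D (nat \<lfloor>s\<rfloor>) x - D (nat \<lfloor>s\<rfloor>) y\<bar> \<le> H * \<bar>x - y\<bar> powr frac s)))"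

definition C_diffeo :: "real \<Rightarrow> (real \<Rightarrow> real) \<Rightarrow> real set \<Rightarrow> real set \<Rightarrow> bool" where
  "C_diffeo s f S S' \<longleftrightarrow>
     bij_betw f S S' \<and> C_class s S f \<and> C_class s S' (the_inv_into S f)"

definition interval_partition :: "real set set \<Rightarrow> bool" where
  "interval_partition \<P> \<longleftrightarrow>
     finite \<P> \<and> disjoint \<P> \<and> \<Union>\<P> \<subseteq> {0..1} \<and> finite ({0..1} - \<Union>\<P>) \<and>
     (\<forall>J\<in>\<P>. \<exists>a b. a < b \<and> J = {a<..<b})"

(* Maps are total functions; their values off the union of \<P> play no role. *)
definition piecewise_onto :: "real \<Rightarrow> real set set \<Rightarrow> (real \<Rightarrow> real) \<Rightarrow> bool" where
  "piecewise_onto s \<P> T \<longleftrightarrow>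
     (\<forall>J\<in>\<P>. \<exists>g. (\<forall>x\<in>J. g x = T x) \<and> C_diffeo s g (closure J) {0..1})"

definition expanding :: "real set set \<Rightarrow> (real \<Rightarrow> real) \<Rightarrow> bool" where
  "expanding \<P> T \<longleftrightarrow> (\<exists>l>1. \<forall>x\<in>\<Union>\<P>. \<bar>deriv T x\<bar> \<ge> l)"

definition lebesgue_invariant :: "real set set \<Rightarrow> (real \<Rightarrow> real) \<Rightarrow> bool" where
  "lebesgue_invariant \<P> T \<longleftrightarrow>
     (\<forall>A\<in>sets borel. A \<subseteq> {0..1} \<longrightarrow>
        emeasure lborel (T -` A \<inter> \<Union>\<P>) = emeasure lborel A)"

(* A branch of T^n is a composition of n branches of T; its domain, an interval of
   monotonicity, is the set of points with a given itinerary up to time n - 1. *)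
definition branches :: "real set set \<Rightarrow> (real \<Rightarrow> real) \<Rightarrow> nat \<Rightarrow> real set set" where
  "branches \<P> T n =
     {{x \<in> {0..1}. \<forall>j<n. (T ^^ j) x \<in> w j} |w. \<forall>j<n. w j \<in> \<P>} - {{}}"

definition top_pressure :: "real set set \<Rightarrow> (real \<Rightarrow> real) \<Rightarrow> (real \<Rightarrow> real) \<Rightarrow> real" where
  "top_pressure \<P> T \<phi> =
     lim (\<lambda>n. ln (\<Sum>J\<in>branches \<P> T n. SUP x\<in>J. exp (\<Sum>j<n. \<phi> ((T ^^ j) x))) / real n)"

definition transfer_operator ::
    "real set set \<Rightarrow> (real \<Rightarrow> real) \<Rightarrow> (real \<Rightarrow> complex) \<Rightarrow> real \<Rightarrow> complex" where
  "transfer_operator \<P> T \<phi> x =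
     (\<Sum>y | y \<in> \<Union>\<P> \<and> T y = x. \<phi> y / complex_of_real \<bar>deriv T y\<bar>)"

end

theory Submission
  imports Defs "HOL-Complex_Analysis.Complex_Analysis"
begin

text \<open>
  Suppose that outside some radius smaller than \<open>1/k\<close> the spectrum of \<open>L\<close> consists of isolated
  points whose Riesz projections have finite rank. On the finite-codimensional subspace
  where finitely many of these projections vanish, \<open>L\<^sup>n\<close> then decays like \<open>\<sigma>\<^sup>n\<close> with \<open>\<sigma> < 1/k\<close>.
  On the other hand there is, for every \<open>n\<close>, an interval \<open>C\<close> of monotonicity of \<open>T\<^sup>n\<close> of length at
  least \<open>k\<^sup>-\<^sup>n\<close>, and \<open>L\<^sup>n\<close> is isometric for the \<open>L\<^sup>1\<close> norm on functions supported in \<open>C\<close>.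
  Cut \<open>C\<close> into \<open>N + 1\<close> equal pieces, where \<open>N\<close> is the codimension. Some nonzero combination of
  their indicators lies in the subspace; its norm in the Banach space is at most a constant times
  the sum of the moduli of the coefficients, whereas the \<open>L\<^sup>1\<close> norm of its image under \<open>L\<^sup>n\<close> is at
  least \<open>k\<^sup>-\<^sup>n / (N + 1)\<close> times this sum. This is impossible for large \<open>n\<close>.
\<close>

section \<open>Complex operators and their resolvents\<close>

text \<open>Makes limits, finite sums and integrals pass through complex scalar multiplication,
  which the Riesz integrals below need throughout.\<close>

lemma bounded_bilinear_scaleC: "bounded_bilinear (scaleC :: complex \<Rightarrow> 'b::complex_banach \<Rightarrow> 'b)"
proof
  fix r :: real and a :: complex and x :: 'b
  show "(r *\<^sub>R a) *\<^sub>C x = r *\<^sub>R (a *\<^sub>C x)"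
    by (metis scaleC_of_real scaleC_scaleC scaleR_conv_of_real)
  show "a *\<^sub>C (r *\<^sub>R x) = r *\<^sub>R (a *\<^sub>C x)"
    by (metis mult.commute scaleC_of_real scaleC_scaleC)
  show "\<exists>K. \<forall>a (b::'b). norm (a *\<^sub>C b) \<le> norm a * norm b * K"
    by (intro exI[of _ 1]) (simp add: norm_scaleC)
qed (simp_all add: scaleC_add_left scaleC_add_right)

interpretation scaleC: bounded_bilinear "scaleC :: complex \<Rightarrow> 'b::complex_banach \<Rightarrow> 'b"
  by (rule bounded_bilinear_scaleC)

lemma scaleC_one [simp]: "1 *\<^sub>C (x::'b::complex_banach) = x"
  using scaleC_of_real[of 1 x] by simp

lemmas scaleC_simps = scaleC_add_left scaleC_add_right scaleC.diff_left scaleC.diff_right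
  scaleC.minus_left scaleC.minus_right scaleC.zero_left scaleC.zero_right

definition complex_linear :: "('b::complex_banach \<Rightarrow> 'b) \<Rightarrow> bool" where
  "complex_linear A \<longleftrightarrow> bounded_linear A \<and> (\<forall>c f. A (c *\<^sub>C f) = c *\<^sub>C A f)"

definition complex_functional :: "('b::complex_banach \<Rightarrow> complex) \<Rightarrow> bool" where
  "complex_functional l \<longleftrightarrow> bounded_linear l \<and> (\<forall>c f. l (c *\<^sub>C f) = c * l f)"

lemma complex_functional_compose:
  "complex_functional l \<Longrightarrow> complex_linear A \<Longrightarrow> complex_functional (\<lambda>f. l (A f))"
  unfolding complex_functional_def complex_linear_def
  by (auto intro: bounded_linear_compose)

text \<open>The solution of \<open>u - S u = f\<close> is the fixed point of the contraction
  \<open>u \<mapsto> f + S u\<close>. Its uniqueness yields linearity of \<open>R\<close> and both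
  inverse identities; the bound comes from
  \<open>norm (R f) \<le> norm f + q * norm (R f)\<close>.\<close>

lemma neumann_inverse:
  fixes S :: "'b::banach \<Rightarrow> 'b"
  assumes S: "bounded_linear S" and q: "0 \<le> q" "q < 1" "\<And>x. norm (S x) \<le> q * norm x"
  obtains R where "bounded_linear R" "\<And>f. R (f - S f) = f" "\<And>f. R f - S (R f) = f"
proof -
  interpret S: bounded_linear S by fact
  have ex1: "\<exists>!u. f + S u = u" for f
    by (rule banach_fix_type[OF q(1,2)])
      (auto simp: dist_norm S.diff[symmetric] intro: q(3))
  define R where "R f = (THE u. f + S u = u)" for f
  have R: "f + S (R f) = R f" for f
    unfolding R_def by (rule theI'[OF ex1])
  have uniq: "R f = u" if "f + S u = u" for f u
    using ex1[of f] R[of f] that by auto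
  have nR: "norm (R f) \<le> norm f * (1 / (1 - q))" for f
  proof -
    have "norm (R f) \<le> norm f + q * norm (R f)"
      by (metis R norm_triangle_le add_left_mono q(3))
    then have "norm (R f) * (1 - q) \<le> norm f" by (simp add: algebra_simps)
    then show ?thesis using q by (simp add: field_simps)
  qed
  show ?thesis
  proof
    show "bounded_linear R"
    proof
      fix f g show "R (f + g) = R f + R g"
        by (rule uniq) (metis R S.add add.assoc add.left_commute)
    next
      fix r f show "R (r *\<^sub>R f) = r *\<^sub>R R f"
        by (rule uniq) (metis R S.scaleR scaleR_add_right)
    next
      show "\<exists>K. \<forall>x. norm (R x) \<le> norm x * K" using nR by blast
    qed
    show "R (f - S f) = f" for f by (rule uniq) simp
    show "R f - S (R f) = f" for f using R[of f] by (metis add_diff_cancel_right')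
  qed
qed

lemma not_in_spectrumI:
  assumes "bounded_linear R" "\<And>f. R (z *\<^sub>C f - A f) = f" "\<And>f. z *\<^sub>C R f - A (R f) = f"
  shows "z \<notin> spectrum A"
  using assms unfolding spectrum_def by blast

text \<open>Off the spectrum a two-sided inverse of \<open>z - A\<close> exists, and
  \<open>inv\<close> can only return that inverse.\<close>

lemma
  assumes "z \<notin> spectrum A"
  shows resolvent_bounded: "bounded_linear (resolvent A z)"
    and resolvent_left: "\<And>f. resolvent A z (z *\<^sub>C f - A f) = f"
    and resolvent_right: "\<And>f. z *\<^sub>C resolvent A z f - A (resolvent A z f) = f"
proof -
  obtain R where R: "bounded_linear R" "\<And>f. R (z *\<^sub>C f - A f) = f" "\<And>f. z *\<^sub>C R f - A (R f) = f"
    using assms unfolding spectrum_def by blast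
  have "resolvent A z = R"
    unfolding resolvent_def by (rule inv_equality) (use R in auto)
  then show "bounded_linear (resolvent A z)" "\<And>f. resolvent A z (z *\<^sub>C f - A f) = f"
    "\<And>f. z *\<^sub>C resolvent A z f - A (resolvent A z f) = f"
    using R by simp_all
qed

text \<open>Gaussian elimination, one equation at a time: an equation with a nonzero coefficient
  removes one unknown, so an excess of unknowns over equations is preserved.\<close>

lemma homogeneous_system_nontrivial_solution:
  fixes a :: "'i \<Rightarrow> 'j \<Rightarrow> 'a::field"
  assumes "finite X" "finite J" "card X < card J"
  obtains c where "\<exists>j\<in>J. c j \<noteq> 0" "\<And>x. x \<in> X \<Longrightarrow> (\<Sum>j\<in>J. c j * a x j) = 0"
proof -
  have "\<exists>c. (\<exists>j\<in>J. c j \<noteq> 0) \<and> (\<forall>x\<in>X. (\<Sum>j\<in>J. c j * a x j) = 0)"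
    using assms
  proof (induction X arbitrary: J a rule: finite_induct)
    case empty
    then have "J \<noteq> {}" by auto
    then show ?case by (intro exI[of _ "\<lambda>_. 1"]) auto
  next
    case (insert x X)
    show ?case
    proof (cases "\<forall>j\<in>J. a x j = 0")
      case True
      obtain c where "\<exists>j\<in>J. c j \<noteq> 0" "\<forall>y\<in>X. (\<Sum>j\<in>J. c j * a y j) = 0"
        using insert.IH[of J a] insert.prems insert.hyps by auto
      then show ?thesis using True by (intro exI[of _ c]) auto
    next
      case False
      then obtain i where i: "i \<in> J" "a x i \<noteq> 0" by auto
      \<comment> \<open>The remaining equations after the unknown \<open>i\<close> has been
        eliminated with the pivot \<open>a x i\<close>.\<close>
      define b where "b y j = a y j - a y i * a x j / a x i" for y j
      have "card X < card (J - {i})"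
        using insert.prems insert.hyps i by simp
      then obtain d where d: "\<exists>j\<in>J-{i}. d j \<noteq> 0" "\<forall>y\<in>X. (\<Sum>j\<in>J-{i}. d j * b y j) = 0"
        using insert.IH[of "J - {i}" b] insert.prems by auto
      define s where "s = (\<Sum>j\<in>J-{i}. d j * a x j)"
      \<comment> \<open>Back substitution: the value at \<open>i\<close> is forced by equation
        \<open>x\<close>.\<close>
      define c where "c j = (if j = i then - s / a x i else d j)" for j
      have split: "(\<Sum>j\<in>J. c j * a y j) = - s / a x i * a y i + (\<Sum>j\<in>J-{i}. d j * a y j)" for y
        using sum.remove[OF \<open>finite J\<close> i(1), of "\<lambda>j. c j * a y j"]
        by (simp add: c_def)
      have "(\<Sum>j\<in>J. c j * a x j) = 0"
        using i(2) unfolding split by (simp add: s_def)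
      moreover have "(\<Sum>j\<in>J. c j * a y j) = 0" if "y \<in> X" for y
      proof -
        have "(\<Sum>j\<in>J-{i}. d j * b y j) = (\<Sum>j\<in>J-{i}. d j * a y j) - (\<Sum>j\<in>J-{i}. (a y i / a x i) * (d j * a x j))"
          unfolding b_def by (simp add: right_diff_distrib sum_subtractf mult_ac)
        also have "\<dots> = (\<Sum>j\<in>J-{i}. d j * a y j) - (a y i / a x i) * s"
          by (simp add: s_def sum_distrib_left)
        finally show ?thesis
          using d(2) that unfolding split by (simp add: mult_ac)
      qed
      moreover have "\<exists>j\<in>J. c j \<noteq> 0" using d(1) by (auto simp: c_def)
      ultimately show ?thesis by (intro exI[of _ c]) auto
    qed
  qed
  then show ?thesis using that by blast
qed

section \<open>Resolvent calculus of a bounded complex-linear operator\<close>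

locale complex_operator =
  fixes A :: "'b::complex_banach \<Rightarrow> 'b"
  assumes lin: "complex_linear A"
begin

abbreviation "R \<equiv> resolvent A"

sublocale A: bounded_linear A
  using lin by (simp add: complex_linear_def)

lemma A_scaleC: "A (c *\<^sub>C f) = c *\<^sub>C A f"
  using lin by (simp add: complex_linear_def)

lemma resolvent_unique:
  assumes "z \<notin> spectrum A" "z *\<^sub>C u - A u = f"
  shows "u = R z f"
  using resolvent_left[OF assms(1), of u] assms(2) by simp

lemma resolvent_complex_linear:
  assumes "z \<notin> spectrum A"
  shows "complex_linear (R z)"
proof -
  have "c *\<^sub>C R z f = R z (c *\<^sub>C f)" for c f
  proof (rule resolvent_unique[OF assms])
    show "z *\<^sub>C c *\<^sub>C R z f - A (c *\<^sub>C R z f) = c *\<^sub>C f"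
      using arg_cong[OF resolvent_right[OF assms, of f], of "scaleC c"]
      by (simp add: A_scaleC scaleC_scaleC mult.commute scaleC.diff_right)
  qed
  then show ?thesis
    using resolvent_bounded[OF assms] by (simp add: complex_linear_def)
qed

lemma resolvent_scaleC: "z \<notin> spectrum A \<Longrightarrow> R z (c *\<^sub>C f) = c *\<^sub>C R z f"
  using resolvent_complex_linear by (simp add: complex_linear_def)

text \<open>Apply \<open>R w\<close> to \<open>(w - A) (R z f) = f + (w - z) R z f\<close>.\<close>

lemma resolvent_identity:
  assumes z: "z \<notin> spectrum A" and w: "w \<notin> spectrum A"
  shows "R z f - R w f = (w - z) *\<^sub>C R w (R z f)"
proof -
  interpret Rw: bounded_linear "R w" using resolvent_bounded[OF w] .
  have "R z f = R w (w *\<^sub>C R z f - A (R z f))" using resolvent_left[OF w] by simp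
  also have "w *\<^sub>C R z f - A (R z f) = f + (w - z) *\<^sub>C R z f"
    using resolvent_right[OF z, of f] by (simp add: scaleC_simps algebra_simps)
  finally show ?thesis
    by (metis Rw.add add_diff_cancel_left' resolvent_scaleC[OF w])
qed

text \<open>Factor \<open>z - A\<close> as \<open>z\<close> times \<open>1 - A/z\<close>; the second
  factor is inverted by the contraction argument, since \<open>A/z\<close> has norm less than
  1.\<close>

lemma outside_norm_not_in_spectrum:
  assumes "onorm A < cmod z"
  shows "z \<notin> spectrum A"
proof -
  have z: "z \<noteq> 0" using assms onorm_pos_le[OF A.bounded_linear_axioms] by auto
  let ?S = "\<lambda>f. (1/z) *\<^sub>C A f"
  have S: "bounded_linear ?S"
    by (intro bounded_linear_compose[OF scaleC.bounded_linear_right] A.bounded_linear_axioms)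
  have "norm (?S x) \<le> (onorm A / cmod z) * norm x" for x
    using onorm[OF A.bounded_linear_axioms, of x] z
    by (simp add: norm_scaleC norm_divide field_simps)
  then obtain Q where Q: "bounded_linear Q" "\<And>f. Q (f - ?S f) = f" "\<And>f. Q f - ?S (Q f) = f"
    using neumann_inverse[OF S, of "onorm A / cmod z"] assms z onorm_pos_le[OF A.bounded_linear_axioms]
    by auto
  show ?thesis
  proof (rule not_in_spectrumI)
    show "bounded_linear (\<lambda>f. Q ((1/z) *\<^sub>C f))"
      by (intro bounded_linear_compose[OF Q(1)] scaleC.bounded_linear_right)
    show "Q ((1/z) *\<^sub>C (z *\<^sub>C f - A f)) = f" for f
      using Q(2)[of f] z by (simp add: scaleC_simps scaleC_scaleC)
    show "z *\<^sub>C Q ((1/z) *\<^sub>C f) - A (Q ((1/z) *\<^sub>C f)) = f" for f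
      using arg_cong[OF Q(3)[of "(1/z) *\<^sub>C f"], of "scaleC z"] z
      by (simp add: scaleC_simps scaleC_scaleC)
  qed
qed

text \<open>Factor \<open>z - A = (w - A) (1 - (w - z) R w)\<close>; the smallness condition makes
  \<open>(w - z) R w\<close> a contraction, so both factors are invertible.\<close>

lemma near_resolvent_not_in_spectrum:
  assumes w: "w \<notin> spectrum A" and M: "\<And>f. norm (R w f) \<le> M * norm f" and M0: "M > 0"
    and near: "cmod (z - w) * M < 1"
  shows "z \<notin> spectrum A"
proof -
  interpret Rw: bounded_linear "R w" using resolvent_bounded[OF w] .
  let ?S = "\<lambda>f. (w - z) *\<^sub>C R w f"
  have S: "bounded_linear ?S"
    by (intro bounded_linear_compose[OF scaleC.bounded_linear_right] Rw.bounded_linear_axioms)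
  have "norm (?S x) \<le> (cmod (z - w) * M) * norm x" for x
    using M[of x] by (simp add: norm_scaleC norm_minus_commute mult.assoc mult_left_mono)
  then obtain Q where Q: "bounded_linear Q" "\<And>f. Q (f - ?S f) = f" "\<And>f. Q f - ?S (Q f) = f"
    using neumann_inverse[OF S, of "cmod (z - w) * M"] near M0 by auto
  have fact1: "z *\<^sub>C f - A f = w *\<^sub>C (f - ?S f) - A (f - ?S f)" for f
  proof -
    have "w *\<^sub>C (f - ?S f) - A (f - ?S f)
        = w *\<^sub>C f - A f - (w - z) *\<^sub>C (w *\<^sub>C R w f - A (R w f))"
      by (simp add: A.diff A.add A_scaleC scaleC_simps scaleC_scaleC algebra_simps)
    then show ?thesis by (simp add: resolvent_right[OF w] scaleC_simps)
  qed
  show ?thesis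
  proof (rule not_in_spectrumI)
    show "bounded_linear (\<lambda>f. Q (R w f))"
      by (intro bounded_linear_compose[OF Q(1)] Rw.bounded_linear_axioms)
    show "Q (R w (z *\<^sub>C f - A f)) = f" for f
      unfolding fact1 by (simp add: resolvent_left[OF w] Q(2))
    show "z *\<^sub>C Q (R w f) - A (Q (R w f)) = f" for f
      unfolding fact1 by (simp add: resolvent_right[OF w] Q(3))
  qed
qed

lemma resolvent_bound:
  assumes w: "w \<notin> spectrum A"
  obtains M where "M > 0" "\<And>f. norm (R w f) \<le> M * norm f"
  using bounded_linear.pos_bounded[OF resolvent_bounded[OF w]] that by (metis mult.commute)

text \<open>Within distance \<open>1 / (2 * M)\<close> of \<open>w\<close> the resolvent identity
  gives \<open>norm (R z f) \<le> M * norm f + norm (R z f) / 2\<close>. Absorbing the last term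
  yields a bound that is uniform in \<open>z\<close>.\<close>

lemma resolvent_bound_near:
  assumes w: "w \<notin> spectrum A"
  obtains M \<epsilon> where "M > 0" "\<epsilon> > 0"
    "\<And>z. z \<in> ball w \<epsilon> \<Longrightarrow> z \<notin> spectrum A"
    "\<And>z f. z \<in> ball w \<epsilon> \<Longrightarrow> norm (R z f) \<le> M * norm f"
proof -
  obtain M where M: "M > 0" "\<And>f. norm (R w f) \<le> M * norm f" using resolvent_bound[OF w] by blast
  show ?thesis
  proof
    show "2 * M > 0" "1 / (2 * M) > 0" using M by auto
    fix z assume "z \<in> ball w (1 / (2 * M))"
    then have d: "cmod (z - w) * M \<le> 1/2"
      using M(1) by (simp add: dist_norm norm_minus_commute field_simps)
    show z: "z \<notin> spectrum A"
      using near_resolvent_not_in_spectrum[OF w M(2,1)] d by simp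
    fix f
    have "R z f = R w f + (w - z) *\<^sub>C R w (R z f)"
      using resolvent_identity[OF z w, of f] by (simp add: algebra_simps)
    then have "norm (R z f) \<le> norm (R w f) + norm ((w - z) *\<^sub>C R w (R z f))"
      by (metis norm_triangle_ineq)
    also have "\<dots> \<le> M * norm f + cmod (z - w) * (M * norm (R z f))"
      unfolding norm_scaleC using M(2)
      by (intro add_mono mult_mono) (auto simp: norm_minus_commute)
    also have "\<dots> \<le> M * norm f + (1/2) * norm (R z f)"
      using mult_right_mono[OF d, of "norm (R z f)"] by (simp add: mult.assoc)
    finally show "norm (R z f) \<le> 2 * M * norm f" by simp
  qed
qed

lemma open_resolvent_set: "open (- spectrum A)"
  unfolding open_contains_ball
proof
  fix w assume "w \<in> - spectrum A"
  then obtain \<epsilon> where "\<epsilon> > 0" "\<And>z. z \<in> ball w \<epsilon> \<Longrightarrow> z \<notin> spectrum A"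
    using resolvent_bound_near[of w] by (metis ComplD)
  then show "\<exists>\<epsilon>>0. ball w \<epsilon> \<subseteq> - spectrum A" by auto
qed

lemma isCont_resolvent:
  assumes w: "w \<notin> spectrum A"
  shows "isCont (\<lambda>z. R z f) w"
proof -
  obtain M \<epsilon> where M: "M > 0" "\<epsilon> > 0"
    "\<And>z. z \<in> ball w \<epsilon> \<Longrightarrow> z \<notin> spectrum A"
    "\<And>z f. z \<in> ball w \<epsilon> \<Longrightarrow> norm (R z f) \<le> M * norm f"
    using resolvent_bound_near[OF w] by metis
  have "\<forall>\<^sub>F z in at w. z \<in> ball w \<epsilon>"
    using M(2) by (intro eventually_at_in_open') auto
  then have "\<forall>\<^sub>F z in at w. norm (R z f - R w f) \<le> cmod (w - z) * (M * (M * norm f))"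
  proof eventually_elim
    case (elim z)
    have "norm (R w (R z f)) \<le> M * (M * norm f)"
      using M(4)[of w "R z f"] M(4)[OF elim, of f] M(1,2)
      by (meson centre_in_ball mult_left_mono order.trans less_imp_le)
    then show ?case
      by (simp add: resolvent_identity[OF M(3)[OF elim] w] norm_scaleC mult_left_mono)
  qed
  moreover have "((\<lambda>z. cmod (w - z) * (M * (M * norm f))) \<longlongrightarrow> cmod (w - w) * (M * (M * norm f))) (at w)"
    by (intro tendsto_intros)
  ultimately have "((\<lambda>z. R z f - R w f) \<longlongrightarrow> 0) (at w)"
    using Lim_null_comparison[of "\<lambda>z. R z f - R w f"] by simp
  then show ?thesis
    unfolding isCont_def by (simp add: LIM_zero_iff)
qed

lemma continuous_on_resolvent: "S \<inter> spectrum A = {} \<Longrightarrow> continuous_on S (\<lambda>z. R z f)"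
  by (intro continuous_at_imp_continuous_on ballI isCont_resolvent) auto

text \<open>By the resolvent identity the difference quotient equals
  \<open>- l (R w (R z f))\<close>, and \<open>R z f\<close> is continuous in \<open>z\<close>.
  Scalar functions are used so that the one-variable theory of holomorphic functions
  applies.\<close>

lemma resolvent_has_field_derivative:
  assumes l: "complex_functional l" and w: "w \<notin> spectrum A"
  shows "((\<lambda>z. l (R z f)) has_field_derivative - l (R w (R w f))) (at w)"
proof -
  interpret l: bounded_linear l using l by (simp add: complex_functional_def)
  interpret Rw: bounded_linear "R w" using resolvent_bounded[OF w] .
  have "((\<lambda>z. - l (R w (R z f))) \<longlongrightarrow> - l (R w (R w f))) (at w)"
    using isCont_resolvent[OF w, of f]
    by (intro tendsto_intros l.tendsto Rw.tendsto) (simp add: isCont_def)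
  moreover have "\<forall>\<^sub>F z in at w. z \<in> - spectrum A - {w}"
    using w open_resolvent_set by (intro eventually_at_in_open) auto
  then have "\<forall>\<^sub>F z in at w. - l (R w (R z f)) = (l (R z f) - l (R w f)) / (z - w)"
  proof eventually_elim
    case (elim z)
    have "l (R z f) - l (R w f) = (w - z) * l (R w (R z f))"
      using elim l by (simp add: resolvent_identity[OF _ w] complex_functional_def flip: l.diff)
    then show ?case using elim by (simp add: field_simps)
  qed
  ultimately show ?thesis
    unfolding has_field_derivative_iff by (rule Lim_transform_eventually)
qed

lemma resolvent_holomorphic:
  assumes "complex_functional l" "S \<inter> spectrum A = {}"
  shows "(\<lambda>z. l (R z f)) holomorphic_on S"
proof (rule holomorphic_onI)
  fix w assume "w \<in> S"
  then have "w \<notin> spectrum A" using assms(2) by auto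
  from has_field_derivative_at_within[OF resolvent_has_field_derivative[OF assms(1) this]]
  show "(\<lambda>z. l (R z f)) field_differentiable at w within S"
    unfolding field_differentiable_def by (rule exI)
qed

text \<open>Cover \<open>S\<close> by finitely many balls with local bounds; the sum of these bounds
  dominates each of them.\<close>

lemma resolvent_bound_compact:
  assumes "compact S" "S \<inter> spectrum A = {}"
  obtains M where "M \<ge> 0" "\<And>z f. z \<in> S \<Longrightarrow> norm (R z f) \<le> M * norm f"
proof -
  have "\<exists>M \<epsilon>. M > 0 \<and> \<epsilon> > 0 \<and> (\<forall>z\<in>ball w \<epsilon>. \<forall>f. norm (R z f) \<le> M * norm f)" if "w \<in> S" for w
  proof -
    have "w \<notin> spectrum A" using that assms(2) by auto
    then obtain M \<epsilon> where "M > 0" "\<epsilon> > 0"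
      "\<And>z f. z \<in> ball w \<epsilon> \<Longrightarrow> norm (R z f) \<le> M * norm f"
      using resolvent_bound_near[of w] by metis
    then show ?thesis
      by (intro exI[of _ M] exI[of _ \<epsilon>] conjI ballI allI)
  qed
  then have "\<forall>w\<in>S. \<exists>M \<epsilon>. M > 0 \<and> \<epsilon> > 0 \<and> (\<forall>z\<in>ball w \<epsilon>. \<forall>f. norm (R z f) \<le> M * norm f)"
    by blast
  from bchoice[OF this] obtain M where
    "\<forall>w\<in>S. \<exists>\<epsilon>. M w > 0 \<and> \<epsilon> > 0 \<and> (\<forall>z\<in>ball w \<epsilon>. \<forall>f. norm (R z f) \<le> M w * norm f)"
    by blast
  from bchoice[OF this] obtain \<epsilon> where M: "\<And>w. w \<in> S \<Longrightarrow> \<epsilon> w > 0"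
    "\<And>w. w \<in> S \<Longrightarrow> M w > 0"
    "\<And>w z f. w \<in> S \<Longrightarrow> z \<in> ball w (\<epsilon> w) \<Longrightarrow> norm (R z f) \<le> M w * norm f"
    by blast
  have "S \<subseteq> (\<Union>w\<in>S. ball w (\<epsilon> w))" using M(1) by auto
  then obtain D where D: "D \<subseteq> S" "finite D" "S \<subseteq> (\<Union>w\<in>D. ball w (\<epsilon> w))"
    using compactE_image[OF assms(1), of S "\<lambda>w. ball w (\<epsilon> w)"] by auto
  show ?thesis
  proof
    show "0 \<le> (\<Sum>w\<in>D. M w)" using D M(2) by (intro sum_nonneg) (auto intro: less_imp_le)
    fix z f assume "z \<in> S"
    then obtain w where w: "w \<in> D" "z \<in> ball w (\<epsilon> w)" using D by auto
    have "norm (R z f) \<le> M w * norm f" using M(3) w D by auto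
    also have "M w \<le> (\<Sum>w\<in>D. M w)"
      using w D M(2) by (intro member_le_sum) (auto intro: less_imp_le)
    finally show "norm (R z f) \<le> (\<Sum>w\<in>D. M w) * norm f" by (simp add: mult_right_mono)
  qed
qed

section \<open>Riesz projections and decay of powers\<close>

text \<open>
  The holomorphic extension of \<open>R(z) f\<close> across an isolated point \<open>z0\<close> of the spectrum, provided that
  the Riesz projection of \<open>f\<close> at \<open>z0\<close> vanishes: the Cauchy integral of the resolvent over the circle
  of radius \<open>e\<close>.
\<close>

definition reduced_resolvent :: "complex \<Rightarrow> real \<Rightarrow> 'b \<Rightarrow> complex \<Rightarrow> 'b" where
  "reduced_resolvent z0 e f z =
     (1 / (2 * complex_of_real pi * \<i>)) *\<^sub>C
       integral {0..2 * pi}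
         (\<lambda>t. (\<i> * complex_of_real e * cis t / (z0 + complex_of_real e * cis t - z)) *\<^sub>C
           R (z0 + complex_of_real e * cis t) f)"

lemma integral_circle_eq_contour_integral:
  "integral {0..2 * pi} (\<lambda>t. \<i> * complex_of_real e * cis t * \<phi> (z0 + complex_of_real e * cis t))
     = contour_integral (circlepath z0 e) \<phi>"
  unfolding circlepath_def by (subst contour_integral_part_circlepath_eq) (auto simp: mult_ac)

lemma
  assumes "e > 0" "spectrum A \<inter> cball z0 e = {z0}"
  shows sphere_disjoint_spectrum: "sphere z0 e \<inter> spectrum A = {}"
    and circle_point: "z0 + complex_of_real e * cis t \<in> sphere z0 e"
proof -
  show "sphere z0 e \<inter> spectrum A = {}"
  proof (rule equals0I)
    fix x assume "x \<in> sphere z0 e \<inter> spectrum A"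
    then have "x \<in> spectrum A \<inter> cball z0 e" by auto
    then show False using assms \<open>x \<in> sphere z0 e \<inter> spectrum A\<close> by simp
  qed
  show "z0 + complex_of_real e * cis t \<in> sphere z0 e"
    using assms by (simp add: dist_norm norm_mult)
qed

lemma continuous_on_resolvent_circle:
  assumes "e > 0" "spectrum A \<inter> cball z0 e = {z0}"
  shows "continuous_on S (\<lambda>t. R (z0 + complex_of_real e * cis t) f)"
  by (rule continuous_on_compose2[OF continuous_on_resolvent[OF sphere_disjoint_spectrum[OF assms]]])
    (use circle_point[OF assms] in \<open>auto intro!: continuous_intros\<close>)

lemma circle_minus_nonzero:
  assumes "e > 0" "z \<in> ball z0 e"
  shows "z0 + complex_of_real e * cis t - z \<noteq> 0"
proof
  assume "z0 + complex_of_real e * cis t - z = 0"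
  then have "z - z0 = complex_of_real e * cis t" by (simp add: algebra_simps)
  then have "cmod (z - z0) = e" using assms(1) by (simp add: norm_mult)
  then show False using assms(2) by (simp add: dist_norm norm_minus_commute)
qed

text \<open>Applying \<open>z - A\<close> to \<open>R \<zeta> f / (\<zeta> - z)\<close> gives
  \<open>f / (\<zeta> - z) - R \<zeta> f\<close>. Over the circle, normalised by
  \<open>2 * pi * \<i>\<close>, the first term integrates to \<open>f\<close> and the second to the
  Riesz projection of \<open>f\<close>, which vanishes.\<close>

lemma reduced_resolvent_right_inverse:
  assumes e: "e > 0" and iso: "spectrum A \<inter> cball z0 e = {z0}"
    and P: "riesz_projection A z0 e f = 0" and z: "z \<in> ball z0 e"
  shows "z *\<^sub>C reduced_resolvent z0 e f z - A (reduced_resolvent z0 e f z) = f"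
proof -
  define \<zeta> where "\<zeta> t = z0 + complex_of_real e * cis t" for t
  define c where "c t = \<i> * complex_of_real e * cis t" for t
  define \<alpha> where "\<alpha> t = c t / (\<zeta> t - z)" for t
  define k where "k = 2 * complex_of_real pi * \<i>"
  have k: "k \<noteq> 0" by (simp add: k_def)
  have nz: "\<zeta> t - z \<noteq> 0" for t
    using circle_minus_nonzero[OF e z] by (simp add: \<zeta>_def)
  have ns: "\<zeta> t \<notin> spectrum A" for t
    using sphere_disjoint_spectrum[OF e iso] circle_point[OF e iso, of t] unfolding \<zeta>_def by blast
  have cR: "continuous_on {0..2*pi} (\<lambda>t. R (\<zeta> t) f)"
    unfolding \<zeta>_def by (rule continuous_on_resolvent_circle[OF e iso])
  have c\<alpha>: "continuous_on {0..2*pi} \<alpha>"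
    unfolding \<alpha>_def c_def \<zeta>_def using circle_minus_nonzero[OF e z]
    by (intro continuous_intros) auto
  have cc: "continuous_on {0..2*pi} c"
    unfolding c_def by (intro continuous_intros)
  define \<Lambda> where "\<Lambda> u = z *\<^sub>C u - A u" for u
  have \<Lambda>: "bounded_linear \<Lambda>"
    unfolding \<Lambda>_def
    by (intro bounded_linear_sub scaleC.bounded_linear_right A.bounded_linear_axioms)
  have int1: "(\<lambda>t. \<alpha> t *\<^sub>C R (\<zeta> t) f) integrable_on {0..2*pi}"
    by (intro integrable_continuous_real scaleC.continuous_on c\<alpha> cR)
  have int2: "(\<lambda>t. c t *\<^sub>C R (\<zeta> t) f) integrable_on {0..2*pi}"
    by (intro integrable_continuous_real scaleC.continuous_on cc cR)
  have int3: "(\<lambda>t. \<alpha> t *\<^sub>C f) integrable_on {0..2*pi}"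
    by (intro integrable_continuous_real scaleC.continuous_on c\<alpha> continuous_intros)
  have int4: "\<alpha> integrable_on {0..2*pi}"
    by (intro integrable_continuous_real c\<alpha>)
  have pointwise: "\<Lambda> (\<alpha> t *\<^sub>C R (\<zeta> t) f) = \<alpha> t *\<^sub>C f - c t *\<^sub>C R (\<zeta> t) f" for t
  proof -
    have AR: "A (R (\<zeta> t) f) = \<zeta> t *\<^sub>C R (\<zeta> t) f - f"
      using resolvent_right[OF ns[of t], of f] by (simp add: algebra_simps)
    have "\<Lambda> (\<alpha> t *\<^sub>C R (\<zeta> t) f)
        = \<alpha> t *\<^sub>C f - (\<alpha> t * (\<zeta> t - z)) *\<^sub>C R (\<zeta> t) f"
      by (simp add: \<Lambda>_def A_scaleC AR scaleC_simps scaleC_scaleC algebra_simps)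
    then show ?thesis using nz[of t] by (simp add: \<alpha>_def)
  qed
  \<comment> \<open>Cauchy's formula for the constant function 1; this is where \<open>z\<close> has
    to lie inside the circle.\<close>
  have "integral {0..2*pi} \<alpha> = contour_integral (circlepath z0 e) (\<lambda>\<zeta>. 1 / (\<zeta> - z))"
    by (subst integral_circle_eq_contour_integral[symmetric]) (simp add: \<alpha>_def[abs_def] c_def \<zeta>_def)
  also have "\<dots> = k"
    using Cauchy_integral_circlepath_simple[of "\<lambda>_. 1" z0 e z] z
    by (auto simp: dist_norm norm_minus_commute k_def intro!: contour_integral_unique)
  finally have i\<alpha>: "integral {0..2*pi} \<alpha> = k" .
  have "integral {0..2*pi} (\<lambda>t. \<alpha> t *\<^sub>C f) = k *\<^sub>C f"
    using integral_linear[OF int4 scaleC.bounded_linear_left, of f] by (simp add: o_def i\<alpha>)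
  moreover have "k *\<^sub>C riesz_projection A z0 e f = integral {0..2*pi} (\<lambda>t. c t *\<^sub>C R (\<zeta> t) f)"
    using k by (simp add: riesz_projection_def scaleC_scaleC c_def \<zeta>_def flip: k_def)
  then have "integral {0..2*pi} (\<lambda>t. c t *\<^sub>C R (\<zeta> t) f) = 0"
    by (simp add: P scaleC_simps)
  ultimately have "\<Lambda> (integral {0..2*pi} (\<lambda>t. \<alpha> t *\<^sub>C R (\<zeta> t) f)) = k *\<^sub>C f"
    using integral_linear[OF int1 \<Lambda>]
    by (simp add: o_def pointwise Henstock_Kurzweil_Integration.integral_diff[OF int3 int2])
  then have "(1/k) *\<^sub>C \<Lambda> (integral {0..2*pi} (\<lambda>t. \<alpha> t *\<^sub>C R (\<zeta> t) f)) = f"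
    using k by (simp add: scaleC_scaleC)
  moreover have "reduced_resolvent z0 e f z = (1/k) *\<^sub>C integral {0..2*pi} (\<lambda>t. \<alpha> t *\<^sub>C R (\<zeta> t) f)"
    by (simp add: reduced_resolvent_def k_def \<alpha>_def c_def \<zeta>_def)
  ultimately show ?thesis
    by (simp add: \<Lambda>_def A_scaleC scaleC_simps scaleC_scaleC mult.commute)
qed

text \<open>After applying \<open>l\<close>, the integral is the Cauchy integral of a continuous
  density on the circle, hence holomorphic inside it.\<close>

lemma reduced_resolvent_holomorphic:
  assumes e: "e > 0" and iso: "spectrum A \<inter> cball z0 e = {z0}"
    and l: "complex_functional l"
  shows "(\<lambda>z. l (reduced_resolvent z0 e f z)) holomorphic_on ball z0 e"
proof -
  define k where "k = 2 * complex_of_real pi * \<i>"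
  define \<phi> where "\<phi> \<zeta> = l (R \<zeta> f)" for \<zeta>
  interpret l: bounded_linear l using l by (simp add: complex_functional_def)
  have cont: "continuous_on (sphere z0 e) \<phi>"
    unfolding \<phi>_def by (intro l.continuous_on continuous_on_resolvent sphere_disjoint_spectrum[OF e iso])
  have eq: "l (reduced_resolvent z0 e f z)
      = (1/k) * contour_integral (circlepath z0 e) (\<lambda>\<zeta>. \<phi> \<zeta> / (\<zeta> - z))"
    if z: "z \<in> ball z0 e" for z
  proof -
    have "(\<lambda>t. (\<i> * complex_of_real e * cis t / (z0 + complex_of_real e * cis t - z)) *\<^sub>C
           R (z0 + complex_of_real e * cis t) f) integrable_on {0..2*pi}"
      using circle_minus_nonzero[OF e z]
      by (intro integrable_continuous_real scaleC.continuous_on continuous_on_resolvent_circle[OF e iso]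
          continuous_intros) auto
    from integral_linear[OF this l.bounded_linear_axioms] show ?thesis
      using l unfolding integral_circle_eq_contour_integral[symmetric]
      by (simp add: reduced_resolvent_def complex_functional_def k_def \<phi>_def o_def)
  qed
  have path: "path_image (circlepath z0 e) = sphere z0 e" using e by simp
  have "(\<lambda>z. contour_integral (circlepath z0 e) (\<lambda>\<zeta>. \<phi> \<zeta> / (\<zeta> - z))) holomorphic_on ball z0 e"
  proof (rule holomorphic_onI)
    fix w assume w: "w \<in> ball z0 e"
    \<comment> \<open>The exponent 1 is kept explicit to match the rule for differentiating Cauchy
      integrals of arbitrary order.\<close>
    have "((\<lambda>u. \<phi> u / (u - w) ^ 1) has_contour_integral
        contour_integral (circlepath z0 e) (\<lambda>\<zeta>. \<phi> \<zeta> / (\<zeta> - w))) (circlepath z0 e)"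
      if "w \<in> ball z0 e" for w
    proof -
      have "continuous_on (sphere z0 e) (\<lambda>u. \<phi> u / (u - w))"
        using that by (intro continuous_intros cont) auto
      then show ?thesis
        using contour_integrable_continuous_circlepath[of z0 e "\<lambda>u. \<phi> u / (u - w)"] path
        by (simp add: has_contour_integral_integral)
    qed
    from Cauchy_next_derivative_circlepath(2)[OF _ this _ w] cont path
    show "(\<lambda>z. contour_integral (circlepath z0 e) (\<lambda>\<zeta>. \<phi> \<zeta> / (\<zeta> - z)))
        field_differentiable at w within ball z0 e"
      by (metis field_differentiable_at_within field_differentiable_def zero_neq_one)
  qed
  then have "(\<lambda>z. (1/k) * contour_integral (circlepath z0 e) (\<lambda>\<zeta>. \<phi> \<zeta> / (\<zeta> - z)))
      holomorphic_on ball z0 e"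
    by (intro holomorphic_intros)
  then show ?thesis
    by (rule holomorphic_transform) (simp add: eq)
qed

text \<open>Vanishing Riesz projections let \<open>R z f\<close> extend holomorphically to all
  \<open>z\<close> with \<open>\<rho> < cmod z\<close>. The coefficients of its expansion at
  infinity are the vectors \<open>(A ^^ n) f\<close>, and Cauchy's estimate on the circle of radius
  \<open>\<sigma>\<close> bounds them, with the resolvent bound \<open>M\<close> on that
  circle.\<close>

lemma power_bound_if_riesz_zero:
  assumes \<rho>: "0 < \<rho>" "\<rho> < \<sigma>"
    and iso: "\<And>z. z \<in> spectrum A \<Longrightarrow> \<rho> < cmod z \<Longrightarrow>
      e z > 0 \<and> spectrum A \<inter> cball z (e z) = {z} \<and> riesz_projection A z (e z) f = 0"
    and \<sigma>: "sphere 0 \<sigma> \<inter> spectrum A = {}"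
    and M: "M \<ge> 0" "\<And>z f. z \<in> sphere 0 \<sigma> \<Longrightarrow> norm (R z f) \<le> M * norm f"
    and l: "complex_functional l" and K: "K \<ge> 0" "\<And>g. cmod (l g) \<le> K * norm g"
  shows "cmod (l ((A ^^ n) f)) \<le> K * M * norm f * \<sigma> ^ Suc n"
proof -
  \<comment> \<open>The extension of \<open>R z f\<close>; at a spectral point it takes the value of
    the reduced resolvent at its own centre.\<close>
  define U where "U z = (if z \<in> spectrum A then reduced_resolvent z (e z) f z else R z f)" for z
  define D where "D = {z :: complex. \<rho> < cmod z}"
  have D: "open D" unfolding D_def by (intro open_Collect_less continuous_intros)
  have U_eq: "z *\<^sub>C U z - A (U z) = f" if "z \<in> D" for z
    using that iso[of z] reduced_resolvent_right_inverse[of "e z" z f z]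
    by (auto simp: U_def D_def resolvent_right)
  \<comment> \<open>Near a spectral point, \<open>U\<close> is a single reduced resolvent: off the
    spectrum, \<open>(z - A) u = f\<close> has only one solution.\<close>
  have U_near: "U z = reduced_resolvent z0 (e z0) f z"
    if z0: "z0 \<in> spectrum A" "z0 \<in> D" and z: "z \<in> ball z0 (e z0)" for z0 z
  proof (cases "z = z0")
    case False
    have i: "e z0 > 0" "spectrum A \<inter> cball z0 (e z0) = {z0}" "riesz_projection A z0 (e z0) f = 0"
      using iso[of z0] z0 by (auto simp: D_def)
    have "z \<notin> spectrum A"
    proof
      assume "z \<in> spectrum A"
      then have "z \<in> spectrum A \<inter> cball z0 (e z0)" using z by simp
      then show False unfolding i(2) using False by simp
    qed
    then show ?thesis
      using resolvent_unique[OF _ reduced_resolvent_right_inverse[OF i z]] by (simp add: U_def)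
  qed (use z0 in \<open>simp add: U_def\<close>)
  have U_holo: "(\<lambda>z. l (U z)) holomorphic_on D" if l: "complex_functional l" for l
  proof -
    have "(\<lambda>z. l (U z)) field_differentiable at w" if w: "w \<in> D" for w
    proof (cases "w \<in> spectrum A")
      case True
      have i: "e w > 0" "spectrum A \<inter> cball w (e w) = {w}"
        using iso[of w] w True by (auto simp: D_def)
      have "(\<lambda>z. l (U z)) holomorphic_on ball w (e w)"
        using reduced_resolvent_holomorphic[OF i l]
        by (rule holomorphic_transform) (simp add: U_near[OF True w])
      then show ?thesis
        using i(1) by (auto intro: holomorphic_on_imp_differentiable_at)
    next
      case False
      have "(\<lambda>z. l (U z)) holomorphic_on - spectrum A"
        by (rule holomorphic_transform[OF resolvent_holomorphic[OF l]]) (auto simp: U_def)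
      then show ?thesis
        using False open_resolvent_set by (auto intro: holomorphic_on_imp_differentiable_at)
    qed
    then show ?thesis
      using holomorphic_onI field_differentiable_at_within by metis
  qed
  \<comment> \<open>In the coordinate \<open>w = 1/z\<close> the resolvent is the generating function of the \<open>l (A\<^sup>n f)\<close>.\<close>
  define G where "G l w = (if w = 0 then l f else l (U (1/w)) / w)" for l :: "'b \<Rightarrow> complex" and w
  define B where "B = ball (0::complex) (1/\<rho>)"
  have B_inv: "1/w \<in> D" if "w \<in> B" "w \<noteq> 0" for w
    using that \<rho> by (simp add: B_def D_def norm_divide field_simps)
  \<comment> \<open>The functional equation that identifies the Taylor coefficients of
    \<open>G l\<close>. It replaces \<open>l\<close> by its composition with \<open>A\<close>, so
    everything about \<open>G\<close> is proved for all functionals at once.\<close>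
  have rec: "G l w = l f + w * G (\<lambda>g. l (A g)) w" if l: "complex_functional l" and w: "w \<in> B" for l w
  proof (cases "w = 0")
    case False
    interpret l: bounded_linear l using l by (simp add: complex_functional_def)
    have "l f = (1/w) * l (U (1/w)) - l (A (U (1/w)))"
      using arg_cong[OF U_eq[OF B_inv[OF w False]], of l] l
      by (simp add: l.diff complex_functional_def)
    then show ?thesis using False by (simp add: G_def)
  qed (simp add: G_def)
  \<comment> \<open>For small \<open>w\<close> the relation \<open>u = w (f + A u)\<close> gives
    \<open>norm u \<le> 2 * cmod w * norm f\<close>, which compensates the division by
    \<open>w\<close> in \<open>G\<close>.\<close>
  have G_bounded: "\<exists>C. \<forall>\<^sub>F w in at 0. cmod (G l w) \<le> C" if l: "complex_functional l" for l
  proof -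
    interpret l: bounded_linear l using l by (simp add: complex_functional_def)
    obtain K where K: "\<And>g. cmod (l g) \<le> norm g * K" using l.bounded by blast
    obtain N where N: "N > 0" "\<And>g. norm (A g) \<le> norm g * N" using A.pos_bounded by blast
    have "\<forall>\<^sub>F w in at 0. w \<in> ball 0 (min (1/\<rho>) (1/(2*N))) - {0::complex}"
      using \<rho> N(1) by (intro eventually_at_in_open) auto
    then have "\<forall>\<^sub>F w in at 0. cmod (G l w) \<le> 2 * norm f * \<bar>K\<bar>"
    proof eventually_elim
      case (elim w)
      then have w: "w \<noteq> 0" "w \<in> B" "cmod w * N \<le> 1/2"
        using N(1) by (auto simp: B_def field_simps)
      define u where "u = U (1/w)"
      have "(1/w) *\<^sub>C u = f + A u"
        using U_eq[OF B_inv[OF w(2,1)]] by (simp add: u_def algebra_simps)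
      then have "u = w *\<^sub>C (f + A u)"
        using w(1) by (metis scaleC_scaleC scaleC_one nonzero_mult_div_cancel_left times_divide_eq_right mult.right_neutral)
      then have "norm u \<le> cmod w * (norm f + norm u * N)"
        using N(2)[of u] norm_triangle_ineq[of f "A u"]
        by (metis norm_scaleC add_left_mono mult_left_mono norm_ge_zero order.trans)
      also have "\<dots> = cmod w * norm f + norm u * (cmod w * N)"
        by (simp add: algebra_simps)
      also have "\<dots> \<le> cmod w * norm f + norm u * (1/2)"
        by (intro add_left_mono mult_left_mono w(3)) auto
      finally have "norm u \<le> cmod w * (2 * norm f)" by simp
      then have "norm u / cmod w \<le> 2 * norm f" using w(1) by (simp add: field_simps)
      then have "norm u / cmod w * \<bar>K\<bar> \<le> 2 * norm f * \<bar>K\<bar>" by (intro mult_right_mono) auto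
      moreover have "cmod (l u) \<le> norm u * \<bar>K\<bar>"
        using K[of u] by (meson abs_ge_self mult_left_mono norm_ge_zero order.trans)
      then have "cmod (l u) / cmod w \<le> norm u / cmod w * \<bar>K\<bar>"
        by (simp add: divide_right_mono)
      ultimately show ?case using w(1) by (simp add: G_def u_def norm_divide)
    qed
    then show ?thesis by blast
  qed
  have lA: "complex_functional (\<lambda>g. l (A g))" if "complex_functional l" for l
    using complex_functional_compose[OF that lin] .
  have G_holo: "G l holomorphic_on B" if l: "complex_functional l" for l
  \<comment> \<open>The singularity at 0, which corresponds to \<open>z = \<infinity>\<close>, is
    removable: \<open>rec\<close> and the bound on \<open>G\<close> for the composed functional show
    that \<open>G l\<close> tends to \<open>l f\<close> there.\<close>
  proof (rule no_isolated_singularity'[where K = "{0}"])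
    have "(\<lambda>w. l (U (1/w)) / w) holomorphic_on B - {0}"
    proof -
      have "(\<lambda>w::complex. 1/w) holomorphic_on B - {0}" by (intro holomorphic_intros) auto
      from holomorphic_on_compose_gen[OF this U_holo[OF l]] B_inv
      have "(\<lambda>w. l (U (1/w))) holomorphic_on B - {0}" by (auto simp: o_def)
      then show ?thesis by (intro holomorphic_intros) auto
    qed
    then show "G l holomorphic_on B - {0}"
      by (rule holomorphic_transform) (auto simp: G_def)
    fix z :: complex assume "z \<in> {0}"
    then have z: "z = 0" by simp
    obtain C where "\<forall>\<^sub>F w in at 0. cmod (G (\<lambda>g. l (A g)) w) \<le> C" using G_bounded[OF lA[OF l]] by blast
    moreover have "\<forall>\<^sub>F w in at (0::complex). w \<in> B"
      using \<rho> by (intro eventually_at_in_open') (auto simp: B_def)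
    ultimately have "\<forall>\<^sub>F w in at 0. cmod (G l w - l f) \<le> cmod w * C"
      by eventually_elim (simp add: rec[OF l] norm_mult mult_left_mono)
    moreover have "((\<lambda>w::complex. cmod w * C) \<longlongrightarrow> cmod 0 * C) (at 0)" by (intro tendsto_intros)
    ultimately have "((\<lambda>w. G l w - l f) \<longlongrightarrow> 0) (at 0)"
      using Lim_null_comparison[of "\<lambda>w. G l w - l f"] by simp
    then have "(G l \<longlongrightarrow> G l z) (at z)"
      using LIM_zero_iff[of "G l" "l f" "at 0"] by (simp add: z G_def)
    then show "(G l \<longlongrightarrow> G l z) (at z within B)" by (rule tendsto_within_subset) simp
  qed (auto simp: B_def)
  have "1/\<sigma> < 1/\<rho>" using \<rho> by (simp add: frac_less2)
  then have sub: "cball 0 (1/\<sigma>) \<subseteq> B" by (auto simp: B_def)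
  have coeff: "((\<lambda>w. G l w / w ^ Suc n) has_contour_integral 2 * pi * \<i> * l ((A ^^ n) f))
      (circlepath 0 (1/\<sigma>))" if "complex_functional l" for l
    using that
  proof (induction n arbitrary: l)
    case 0
    have "G l holomorphic_on cball 0 (1/\<sigma>)" using holomorphic_on_subset[OF G_holo[OF 0] sub] .
    then show ?case
      using Cauchy_integral_circlepath_simple[of "G l" 0 "1/\<sigma>" 0] \<rho> by (simp add: G_def)
  next
    case (Suc n)
    \<comment> \<open>The constant term of \<open>rec\<close> contributes nothing: a constant
      divided by a power of \<open>w\<close> of order at least 2 integrates to zero around
      0.\<close>
    have "((\<lambda>w. l f / w ^ Suc (Suc n)) has_contour_integral 0) (circlepath 0 (1/\<sigma>))"
      using Cauchy_has_contour_integral_higher_derivative_circlepath[of 0 "1/\<sigma>" "\<lambda>_. l f" 0 "Suc n"] \<rho>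
      by simp
    from has_contour_integral_add[OF this Suc.IH[OF lA[OF Suc.prems]]]
    have "((\<lambda>w. l f / w ^ Suc (Suc n) + G (\<lambda>g. l (A g)) w / w ^ Suc n) has_contour_integral
        2 * pi * \<i> * l ((A ^^ Suc n) f)) (circlepath 0 (1/\<sigma>))"
      by simp
    then show ?case
    proof (rule has_contour_integral_eq)
      fix w :: complex assume "w \<in> path_image (circlepath 0 (1/\<sigma>))"
      then have w: "w \<in> B" "w \<noteq> 0" using sub \<rho> by auto
      show "l f / w ^ Suc (Suc n) + G (\<lambda>g. l (A g)) w / w ^ Suc n = G l w / w ^ Suc (Suc n)"
        using w(2) by (simp add: rec[OF Suc.prems w(1)] field_simps)
    qed
  qed
  \<comment> \<open>The integrand carries \<open>\<sigma> ^ (n+2)\<close>: \<open>n+1\<close>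
    factors from the power of \<open>w\<close> and one from the division in \<open>G\<close>. The
    circle has length \<open>2 * pi / \<sigma>\<close>, which leaves the exponent
    \<open>Suc n\<close>.\<close>
  have "cmod (2 * pi * \<i> * l ((A ^^ n) f)) \<le> (K * M * norm f * \<sigma> ^ (n+2)) * (2 * pi * (1/\<sigma>))"
  proof (rule has_contour_integral_bound_circlepath[OF coeff[OF l]])
    fix w :: complex assume "cmod (w - 0) = 1/\<sigma>"
    then have w: "cmod w = 1/\<sigma>" "w \<noteq> 0" using \<rho> by auto
    then have s: "1/w \<in> sphere 0 \<sigma>" by (simp add: norm_divide)
    then have "U (1/w) = R (1/w) f" using \<sigma> by (auto simp: U_def)
    then have "cmod (l (U (1/w))) \<le> K * (M * norm f)"
      using K(2)[of "R (1/w) f"] M(2)[OF s, of f] K(1) by (metis mult_left_mono order.trans)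
    then have "cmod (l (U (1/w))) * \<sigma> ^ (n+2) \<le> K * (M * norm f) * \<sigma> ^ (n+2)"
      using \<rho> by (intro mult_right_mono) auto
    moreover have "cmod (G l w / w ^ Suc n) = cmod (l (U (1/w))) / (1/\<sigma>) / (1/\<sigma>) ^ Suc n"
      using w(2) by (simp only: G_def norm_divide norm_power if_False w(1))
    then have "cmod (G l w / w ^ Suc n) = cmod (l (U (1/w))) * \<sigma> ^ (n+2)"
      by (simp add: power_divide)
    ultimately show "cmod (G l w / w ^ Suc n) \<le> K * M * norm f * \<sigma> ^ (n+2)"
      by (simp add: mult.assoc)
  qed (use \<rho> K M in auto)
  also have "\<dots> = (2 * pi) * (K * M * norm f * \<sigma> ^ Suc n)"
    using \<rho> by (simp add: field_simps)
  finally show ?thesis by (simp add: norm_mult)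
qed

section \<open>Riesz projections as finitely many linear conditions\<close>

lemma
  assumes e: "e > 0" and iso: "spectrum A \<inter> cball z0 e = {z0}"
  shows riesz_projection_add:
      "riesz_projection A z0 e (f + g) = riesz_projection A z0 e f + riesz_projection A z0 e g"
    and riesz_projection_scaleC:
      "riesz_projection A z0 e (c *\<^sub>C f) = c *\<^sub>C riesz_projection A z0 e f"
proof -
  define \<zeta> where "\<zeta> t = z0 + complex_of_real e * cis t" for t
  define d where "d t = \<i> * complex_of_real e * cis t" for t
  have ns: "\<zeta> t \<notin> spectrum A" for t
    using sphere_disjoint_spectrum[OF e iso] circle_point[OF e iso, of t] unfolding \<zeta>_def by blast
  have int: "(\<lambda>t. d t *\<^sub>C R (\<zeta> t) f) integrable_on {0..2*pi}" for f
    unfolding d_def \<zeta>_def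
    by (intro integrable_continuous_real scaleC.continuous_on continuous_intros
        continuous_on_resolvent_circle[OF e iso])
  have eq: "riesz_projection A z0 e f
      = (1 / (2 * complex_of_real pi * \<i>)) *\<^sub>C integral {0..2*pi} (\<lambda>t. d t *\<^sub>C R (\<zeta> t) f)" for f
    by (simp add: riesz_projection_def d_def \<zeta>_def)
  have "R (\<zeta> t) (f + g) = R (\<zeta> t) f + R (\<zeta> t) g" for t
    using resolvent_bounded[OF ns[of t]] by (simp add: bounded_linear.linear linear_add)
  then show "riesz_projection A z0 e (f + g) = riesz_projection A z0 e f + riesz_projection A z0 e g"
    by (simp add: eq scaleC_add_right Henstock_Kurzweil_Integration.integral_add[OF int int])
  have "(\<lambda>t. d t *\<^sub>C R (\<zeta> t) (c *\<^sub>C f)) = scaleC c \<circ> (\<lambda>t. d t *\<^sub>C R (\<zeta> t) f)"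
    by (rule ext) (simp add: resolvent_scaleC[OF ns] scaleC_scaleC mult.commute)
  then have "integral {0..2*pi} (\<lambda>t. d t *\<^sub>C R (\<zeta> t) (c *\<^sub>C f))
      = c *\<^sub>C integral {0..2*pi} (\<lambda>t. d t *\<^sub>C R (\<zeta> t) f)"
    by (simp only: integral_linear[OF int scaleC.bounded_linear_right])
  then show "riesz_projection A z0 e (c *\<^sub>C f) = c *\<^sub>C riesz_projection A z0 e f"
    by (simp add: eq scaleC_scaleC mult.commute[of c])
qed

lemma riesz_projection_sum:
  assumes "e > 0" "spectrum A \<inter> cball z0 e = {z0}" "finite J"
  shows "riesz_projection A z0 e (\<Sum>j\<in>J. c j *\<^sub>C g j) = (\<Sum>j\<in>J. c j *\<^sub>C riesz_projection A z0 e (g j))"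
  using assms(3)
proof (induction J rule: finite_induct)
  case empty
  show ?case using riesz_projection_scaleC[OF assms(1,2), of 0 0] by (simp add: scaleC_simps)
qed (simp add: riesz_projection_add[OF assms(1,2)] riesz_projection_scaleC[OF assms(1,2)])

text \<open>The spectrum lies in the closed disc of radius \<open>onorm A\<close>, so the set in
  question sits in a compact annulus. No point there is a limit of spectrum: spectral points are
  isolated, and the resolvent set is open.\<close>

lemma finite_spectrum_outside:
  assumes iso: "\<And>z. z \<in> spectrum A \<Longrightarrow> \<rho> \<le> cmod z \<Longrightarrow> \<exists>e>0. spectrum A \<inter> cball z e = {z}"
  shows "finite (spectrum A \<inter> {z. \<rho> \<le> cmod z})"
proof -
  let ?K = "cball 0 (onorm A) \<inter> {z. \<rho> \<le> cmod z}"
  have "compact ?K"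
    by (intro compact_Int_closed compact_cball closed_Collect_le continuous_intros)
  moreover have "\<not> z islimpt spectrum A" if z: "z \<in> ?K" for z
  proof (cases "z \<in> spectrum A")
    case True
    then obtain e where e: "e > 0" "spectrum A \<inter> cball z e = {z}" using iso z by auto
    show ?thesis
    proof
      assume "z islimpt spectrum A"
      then obtain y where "y \<in> spectrum A" "y \<noteq> z" "dist y z < e"
        using e(1) unfolding islimpt_approachable by blast
      then have "y \<in> spectrum A \<inter> cball z e" by (simp add: dist_commute)
      then show False unfolding e(2) using \<open>y \<noteq> z\<close> by simp
    qed
  next
    case False
    then show ?thesis
      using open_resolvent_set by (metis ComplI closed_limpt open_closed double_complement)
  qed
  ultimately have "finite (?K \<inter> spectrum A)" by (rule finite_not_islimpt_in_compact)
  moreover have "spectrum A \<inter> {z. \<rho> \<le> cmod z} \<subseteq> ?K \<inter> spectrum A"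
    using outside_norm_not_in_spectrum by (auto simp: not_less[symmetric])
  ultimately show ?thesis by (rule finite_subset[rotated])
qed

text \<open>Codimension is expressed by combinations: among more than \<open>N\<close> vectors some
  nontrivial one is annihilated by all relevant Riesz projections. The constants
  \<open>\<sigma>\<close>, \<open>M\<close>, \<open>N\<close> come before the vectors, so the
  vectors may later vary with the power of \<open>A\<close>.\<close>

lemma geometric_decay_on_finite_codimension:
  assumes \<rho>0: "0 \<le> \<rho>0" "\<rho>0 < \<tau>"
    and iso: "\<And>z. z \<in> spectrum A \<Longrightarrow> \<rho>0 < cmod z \<Longrightarrow> isolated_eigenvalue_of_finite_multiplicity A z"
  obtains \<sigma> M N where "0 < \<sigma>" "\<sigma> < \<tau>" "M \<ge> 0"
    "\<And>(J :: nat set) g. finite J \<Longrightarrow> N < card J \<Longrightarrow>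
      \<exists>c. (\<exists>j\<in>J. c j \<noteq> 0) \<and> (\<forall>l K n. complex_functional l \<longrightarrow> 0 \<le> K \<longrightarrow> (\<forall>h. cmod (l h) \<le> K * norm h) \<longrightarrow>
        cmod (l ((A ^^ n) (\<Sum>j\<in>J. c j *\<^sub>C g j))) \<le> K * M * norm (\<Sum>j\<in>J. c j *\<^sub>C g j) * \<sigma> ^ Suc n)"
proof -
  \<comment> \<open>Strictly above \<open>\<rho>0\<close>, so that even the closed condition
    \<open>\<rho> \<le> cmod z\<close> selects only isolated spectral points, and there are finitely
    many of them.\<close>
  define \<rho> where "\<rho> = (\<rho>0 + \<tau>) / 2"
  have \<rho>: "0 < \<rho>" "\<rho>0 < \<rho>" "\<rho> < \<tau>" using \<rho>0 by (auto simp: \<rho>_def)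
  define Z where "Z = spectrum A \<inter> {z. \<rho> \<le> cmod z}"
  have "\<forall>z\<in>Z. \<exists>e F. e > 0 \<and> spectrum A \<inter> cball z e = {z} \<and> finite F \<and>
      (\<forall>f. \<exists>c. riesz_projection A z e f = (\<Sum>g\<in>F. c g *\<^sub>C g))"
  proof
    fix z assume "z \<in> Z"
    then have "isolated_eigenvalue_of_finite_multiplicity A z" using iso[of z] \<rho>(2) by (simp add: Z_def)
    then show "\<exists>e F. e > 0 \<and> spectrum A \<inter> cball z e = {z} \<and> finite F \<and>
      (\<forall>f. \<exists>c. riesz_projection A z e f = (\<Sum>g\<in>F. c g *\<^sub>C g))"
      unfolding isolated_eigenvalue_of_finite_multiplicity_def by (elim conjE exE) (intro exI conjI)
  qed
  from bchoice[OF this] obtain e where "\<forall>z\<in>Z. \<exists>F. e z > 0 \<and> spectrum A \<inter> cball z (e z) = {z} \<and> finite F \<and>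
      (\<forall>f. \<exists>c. riesz_projection A z (e z) f = (\<Sum>g\<in>F. c g *\<^sub>C g))" by blast
  from bchoice[OF this] obtain F where F: "\<forall>z\<in>Z. e z > 0 \<and> spectrum A \<inter> cball z (e z) = {z} \<and> finite (F z) \<and>
      (\<forall>f. \<exists>c. riesz_projection A z (e z) f = (\<Sum>g\<in>F z. c g *\<^sub>C g))" by blast
  have e: "e z > 0" "spectrum A \<inter> cball z (e z) = {z}" "finite (F z)" if "z \<in> Z" for z
    using bspec[OF F that] by simp_all
  \<comment> \<open>These chosen coefficients need not be linear in \<open>f\<close>. It suffices to
    fix them for each vector \<open>g j\<close>, because the projection itself is linear.\<close>
  define C where "C z f = (SOME c. riesz_projection A z (e z) f = (\<Sum>g\<in>F z. c g *\<^sub>C g))" for z f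
  have C: "riesz_projection A z (e z) f = (\<Sum>g\<in>F z. C z f g *\<^sub>C g)" if "z \<in> Z" for z f
  proof -
    have "\<exists>c. riesz_projection A z (e z) f = (\<Sum>g\<in>F z. c g *\<^sub>C g)"
      using bspec[OF F that] by simp
    from someI_ex[OF this] show ?thesis by (simp only: C_def)
  qed
  have finZ: "finite Z"
    unfolding Z_def
  proof (rule finite_spectrum_outside)
    fix z assume "z \<in> spectrum A" "\<rho> \<le> cmod z"
    then have "z \<in> Z" by (simp add: Z_def)
    then show "\<exists>e>0. spectrum A \<inter> cball z e = {z}" by (intro exI[of _ "e z"] conjI e)
  qed
  \<comment> \<open>Choose a radius that misses the finitely many moduli of points of
    \<open>Z\<close>, so that the circle of radius \<open>\<sigma>\<close> avoids the
    spectrum.\<close>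
  then have "infinite ({\<rho><..<\<tau>} - cmod ` Z)"
    using \<rho> by (intro Diff_infinite_finite finite_imageI) (auto simp: infinite_Ioo)
  then obtain \<sigma> where "\<sigma> \<in> {\<rho><..<\<tau>} - cmod ` Z"
    using infinite_imp_nonempty by blast
  then have \<sigma>: "\<rho> < \<sigma>" "\<sigma> < \<tau>" "\<sigma> \<notin> cmod ` Z" by auto
  have sph: "sphere 0 \<sigma> \<inter> spectrum A = {}"
    using \<sigma> by (auto simp: Z_def image_iff)
  obtain M where M: "M \<ge> 0" "\<And>z f. z \<in> sphere 0 \<sigma> \<Longrightarrow> norm (R z f) \<le> M * norm f"
    using resolvent_bound_compact[OF compact_sphere sph] by metis
  \<comment> \<open>One scalar equation for each spectral point and each spanning vector of the
    range of its projection.\<close>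
  define X where "X = Sigma Z F"
  have finX: "finite X" using finZ e(3) by (auto simp: X_def)
  show ?thesis
  proof (rule that[of \<sigma> M "card X"])
    show "0 < \<sigma>" "\<sigma> < \<tau>" "M \<ge> 0" using \<rho> \<sigma> M by auto
    fix J :: "nat set" and g :: "nat \<Rightarrow> 'b"
    assume J: "finite J" "card X < card J"
    obtain c where c: "\<exists>j\<in>J. c j \<noteq> 0"
      "\<And>x. x \<in> X \<Longrightarrow> (\<Sum>j\<in>J. c j * C (fst x) (g j) (snd x)) = 0"
      using homogeneous_system_nontrivial_solution[OF finX J, of "\<lambda>x j. C (fst x) (g j) (snd x)"] by metis
    define f where "f = (\<Sum>j\<in>J. c j *\<^sub>C g j)"
    have "riesz_projection A z (e z) f = 0" if z: "z \<in> Z" for z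
    proof -
      have "riesz_projection A z (e z) f = (\<Sum>j\<in>J. \<Sum>h\<in>F z. (c j * C z (g j) h) *\<^sub>C h)"
        unfolding f_def riesz_projection_sum[OF e(1,2)[OF z] J(1)]
        by (simp add: C[OF z] scaleC.sum_right scaleC_scaleC)
      also have "\<dots> = (\<Sum>h\<in>F z. (\<Sum>j\<in>J. c j * C z (g j) h) *\<^sub>C h)"
        by (subst sum.swap) (simp add: scaleC.sum_left)
      also have "\<dots> = 0"
        using c(2)[of "(z, _)"] z by (intro sum.neutral) (auto simp: X_def scaleC_simps)
      finally show ?thesis .
    qed
    then have "\<And>z. z \<in> spectrum A \<Longrightarrow> \<rho> < cmod z \<Longrightarrow>
      e z > 0 \<and> spectrum A \<inter> cball z (e z) = {z} \<and> riesz_projection A z (e z) f = 0"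
      using e by (simp add: Z_def)
    from power_bound_if_riesz_zero[OF \<rho>(1) \<sigma>(1) this sph M]
    have "\<forall>l K n. complex_functional l \<longrightarrow> 0 \<le> K \<longrightarrow> (\<forall>h. cmod (l h) \<le> K * norm h) \<longrightarrow>
        cmod (l ((A ^^ n) f)) \<le> K * M * norm f * \<sigma> ^ Suc n" by blast
    then show "\<exists>c. (\<exists>j\<in>J. c j \<noteq> 0) \<and> (\<forall>l K n. complex_functional l \<longrightarrow> 0 \<le> K \<longrightarrow> (\<forall>h. cmod (l h) \<le> K * norm h) \<longrightarrow>
        cmod (l ((A ^^ n) (\<Sum>j\<in>J. c j *\<^sub>C g j))) \<le> K * M * norm (\<Sum>j\<in>J. c j *\<^sub>C g j) * \<sigma> ^ Suc n)"
      using c(1) unfolding f_def by blast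
  qed
qed

end

section \<open>Transfer operators of piecewise expanding maps\<close>

text \<open>The endpoints are the infimum and supremum of \<open>C\<close>; passing to the open
  interval loses no length.\<close>

lemma interval_contains_open_interval:
  fixes C :: "real set"
  assumes C: "is_interval C" "C \<subseteq> {0..1}" and pos: "0 < measure lborel C"
  obtains a b where "measure lborel C \<le> b - a" "{a<..<b} \<subseteq> C"
proof
  have ne: "C \<noteq> {}" using pos by auto
  have bdd: "bdd_below C" "bdd_above C"
    using bdd_below_mono[OF bdd_below_Icc C(2)] bdd_above_mono[OF bdd_above_Icc C(2)] .
  have sub: "C \<subseteq> {Inf C..Sup C}" using bdd by (auto intro: cInf_lower cSup_upper)
  then have "Inf C \<le> Sup C" using ne by fastforce
  have "measure lborel C \<le> measure lborel {Inf C..Sup C}"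
    using sub real_interval_borel_measurable[OF C(1)]
      emeasure_lborel_Icc[OF \<open>Inf C \<le> Sup C\<close>]
    by (intro measure_mono_fmeasurable) (auto simp: fmeasurable_def)
  then show "measure lborel C \<le> Sup C - Inf C" using \<open>Inf C \<le> Sup C\<close> by simp
  show "{Inf C<..<Sup C} \<subseteq> C"
  proof
    fix x assume "x \<in> {Inf C<..<Sup C}"
    then obtain y z where "y \<in> C" "y < x" "z \<in> C" "x < z"
      using less_cSup_iff[OF ne bdd(2)] cInf_less_iff[OF ne bdd(1)] by auto
    then show "x \<in> C" using C(1) unfolding is_interval_1 by (meson less_imp_le)
  qed
qed

lemma disjoint_indicator_sum_norm:
  fixes c :: "'i \<Rightarrow> complex"
  assumes "finite J" "disjoint_family_on I J"
  shows "cmod (\<Sum>j\<in>J. c j * indicator (I j) x) = (\<Sum>j\<in>J. cmod (c j) * indicator (I j) x)"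
proof (cases "\<exists>i\<in>J. x \<in> I i")
  case True
  then obtain i where i: "i \<in> J" "x \<in> I i" by blast
  then have "x \<notin> I j" if "j \<in> J" "j \<noteq> i" for j
    using assms(2) that unfolding disjoint_family_on_def by blast
  then have "(\<Sum>j\<in>J. c j * indicator (I j) x) = (\<Sum>j\<in>{i}. c j * indicator (I j) x)"
    "(\<Sum>j\<in>J. cmod (c j) * indicator (I j) x) = (\<Sum>j\<in>{i}. cmod (c j) * indicator (I j) x)"
    using assms(1) i by (intro sum.mono_neutral_right; auto)+
  then show ?thesis using i(2) by simp
qed auto

text \<open>Regularity and expansion are recorded as differentiability with a nonzero derivative on
  injective branches, the form in which the change of variables formula uses them.\<close>

locale piecewise_expanding_map =
  fixes \<P> :: "real set set" and T :: "real \<Rightarrow> real"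
  assumes part: "interval_partition \<P>"
    and maps: "T \<in> \<Union>\<P> \<rightarrow> {0..1}"
    and has_deriv: "\<And>x. x \<in> \<Union>\<P> \<Longrightarrow> (T has_real_derivative deriv T x) (at x)"
    and deriv_nonzero: "\<And>x. x \<in> \<Union>\<P> \<Longrightarrow> deriv T x \<noteq> 0"
    and inj_branch: "\<And>J. J \<in> \<P> \<Longrightarrow> inj_on T J"
begin

lemma
  shows finite_partition: "finite \<P>"
    and branch_interval: "J \<in> \<P> \<Longrightarrow> is_interval J"
    and branch_open: "J \<in> \<P> \<Longrightarrow> open J"
    and partition_subset: "\<Union>\<P> \<subseteq> {0..1}"
    and partition_disjoint: "disjoint \<P>"
    and partition_nonempty: "\<P> \<noteq> {}"
proof -
  show "finite \<P>" "\<Union>\<P> \<subseteq> {0..1}" "disjoint \<P>"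
    using part by (auto simp: interval_partition_def)
  show "is_interval J" "open J" if "J \<in> \<P>"
    using part that by (auto simp: interval_partition_def)
  have "finite ({0..1::real} - \<Union>\<P>)" using part by (auto simp: interval_partition_def)
  then show "\<P> \<noteq> {}" by (auto simp: infinite_Icc)
qed

text \<open>On a branch \<open>T\<close> is continuous and injective, so values at intermediate
  points lie strictly between the values at the ends.\<close>

lemma cylinder_interval:
  assumes J: "J \<in> \<P>" and C: "is_interval C"
  shows "is_interval {x \<in> J. T x \<in> C}"
  unfolding is_interval_1
proof (intro ballI allI impI)
  fix a b x assume ab: "a \<in> {x \<in> J. T x \<in> C}" "b \<in> {x \<in> J. T x \<in> C}" and x: "a \<le> x \<and> x \<le> b"
  have sub: "{a..b} \<subseteq> J"
    using branch_interval[OF J] ab unfolding is_interval_1 by auto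
  show "x \<in> {x \<in> J. T x \<in> C}"
  proof (cases "x = a \<or> x = b")
    case False
    have "continuous_on {a..b} T"
      using sub J by (intro continuous_at_imp_continuous_on ballI DERIV_isCont[OF has_deriv]) auto
    moreover have "inj_on T {a..b}" using inj_branch[OF J] sub by (rule inj_on_subset)
    ultimately have "T a < T x \<and> T x < T b \<or> T b < T x \<and> T x < T a"
      using False x by (intro continuous_inj_imp_mono) auto
    then have "T x \<in> C"
      using C ab unfolding is_interval_1 by (blast intro: less_imp_le)
    moreover have "x \<in> J" using sub x by auto
    ultimately show ?thesis by simp
  qed (use ab in auto)
qed

text \<open>The transfer operator is well defined on classes: differentiable maps send null sets to
  null sets, and outside the image of the exceptional set the two sums agree term by term.\<close>

lemma transfer_operator_AE_cong:
  assumes "AE x in lebesgue_on {0..1}. \<phi> x = \<psi> x"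
  shows "AE x in lebesgue_on {0..1}. transfer_operator \<P> T \<phi> x = transfer_operator \<P> T \<psi> x"
proof -
  have "AE x in lebesgue. x \<in> {0..1} \<longrightarrow> \<phi> x = \<psi> x"
    using assms by (subst (asm) AE_restrict_space_iff) auto
  then obtain N where N: "\<And>x. x \<in> {0..1} \<Longrightarrow> x \<notin> N \<Longrightarrow> \<phi> x = \<psi> x" "N \<in> null_sets lebesgue"
    by (rule AE_E3) auto
  have "negligible (T ` (N \<inter> \<Union>\<P>))"
  proof (rule negligible_differentiable_image_negligible)
    show "negligible (N \<inter> \<Union>\<P>)" using N(2) by (auto simp: negligible_iff_null_sets[symmetric] intro: negligible_subset)
    show "T differentiable_on N \<inter> \<Union>\<P>"
      unfolding differentiable_on_def
    proof
      fix x assume "x \<in> N \<inter> \<Union>\<P>"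
      then have "T differentiable at x" using has_deriv[of x] real_differentiable_def by blast
      then show "T differentiable at x within N \<inter> \<Union>\<P>" by (rule differentiable_at_withinI)
    qed
  qed simp
  then have "T ` (N \<inter> \<Union>\<P>) \<in> null_sets lebesgue" by (simp add: negligible_iff_null_sets)
  then have "AE x in lebesgue. x \<in> {0..1} \<longrightarrow> transfer_operator \<P> T \<phi> x = transfer_operator \<P> T \<psi> x"
  proof (rule AE_I', intro subsetI)
    fix x assume x: "x \<in> {x \<in> space lebesgue. \<not> (x \<in> {0..1} \<longrightarrow> transfer_operator \<P> T \<phi> x = transfer_operator \<P> T \<psi> x)}"
    show "x \<in> T ` (N \<inter> \<Union>\<P>)"
    proof (rule ccontr)
      assume "x \<notin> T ` (N \<inter> \<Union>\<P>)"
      then have "\<phi> y = \<psi> y" if "y \<in> \<Union>\<P>" "T y = x" for y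
        using N(1)[of y] partition_subset that by blast
      then have "transfer_operator \<P> T \<phi> x = transfer_operator \<P> T \<psi> x"
        unfolding transfer_operator_def by (intro sum.cong) auto
      then show False using x by auto
    qed
  qed
  then show ?thesis by (subst AE_restrict_space_iff) auto
qed

lemma transfer_operator_scale:
  "transfer_operator \<P> T (\<lambda>y. c * \<phi> y) x = c * transfer_operator \<P> T \<phi> x"
  by (simp add: transfer_operator_def sum_distrib_left)

lemma transfer_operator_off_image:
  assumes "\<And>y. y \<in> \<Union>\<P> \<Longrightarrow> T y = x \<Longrightarrow> \<phi> y = 0"
  shows "transfer_operator \<P> T \<phi> x = 0"
  unfolding transfer_operator_def using assms by (intro sum.neutral) auto

text \<open>By injectivity on \<open>J\<close>, only the preimage \<open>y\<close> of
  \<open>T y\<close> contributes to the sum.\<close>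

lemma transfer_operator_on_branch:
  assumes J: "J \<in> \<P>" and y: "y \<in> J" and supp: "\<And>y. y \<in> \<Union>\<P> - J \<Longrightarrow> \<phi> y = 0"
  shows "transfer_operator \<P> T \<phi> (T y) = \<phi> y / complex_of_real \<bar>deriv T y\<bar>"
proof -
  let ?S = "{z. z \<in> \<Union>\<P> \<and> T z = T y}"
  have "?S \<subseteq> (\<Union>K\<in>\<P>. T -` {T y} \<inter> K)" by auto
  moreover have "finite (\<Union>K\<in>\<P>. T -` {T y} \<inter> K)"
    by (intro finite_UN_I finite_partition finite_vimage_IntI inj_branch) auto
  ultimately have "finite ?S" by (rule finite_subset)
  moreover have "\<phi> z / complex_of_real \<bar>deriv T z\<bar> = 0" if "z \<in> ?S - {y}" for z
  proof -
    have "z \<notin> J" using that inj_onD[OF inj_branch[OF J], of z y] y by auto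
    then show ?thesis using that supp by simp
  qed
  ultimately have "(\<Sum>z\<in>?S. \<phi> z / complex_of_real \<bar>deriv T z\<bar>) = (\<Sum>z\<in>{y}. \<phi> z / complex_of_real \<bar>deriv T z\<bar>)"
    using J y by (intro sum.mono_neutral_right) auto
  then show ?thesis by (simp add: transfer_operator_def)
qed

lemma transfer_operator_isometry_on_branch:
  assumes J: "J \<in> \<P>" and supp: "\<And>y. y \<notin> J \<Longrightarrow> \<phi> y = 0"
    and int: "integrable (lebesgue_on {0..1}) \<phi>"
  shows "integrable (lebesgue_on {0..1}) (\<lambda>x. cmod (transfer_operator \<P> T \<phi> x))" (is ?int)
    and "(LINT x|lebesgue_on {0..1}. cmod (transfer_operator \<P> T \<phi> x))
      = (LINT x|lebesgue_on {0..1}. cmod (\<phi> x))" (is ?eq)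
proof -
  let ?\<psi> = "\<lambda>x. cmod (transfer_operator \<P> T \<phi> x)"
  have J01: "J \<subseteq> {0..1}" and TJ: "T ` J \<subseteq> {0..1}"
    using partition_subset maps J by blast+
  have Jm: "J \<in> sets lebesgue" using branch_open[OF J] by auto
  have "integrable lebesgue (\<lambda>x. indicator {0..1} x *\<^sub>R \<phi> x)"
    using int by (subst (asm) integrable_restrict_space) auto
  moreover have "indicator {0..1} x *\<^sub>R \<phi> x = indicator J x *\<^sub>R \<phi> x" for x
    using supp J01 by (auto simp: indicator_def)
  ultimately have "set_integrable lebesgue J \<phi>" by (simp add: set_integrable_def)
  then have abs: "(\<lambda>x. cmod (\<phi> x)) absolutely_integrable_on J"
    by (rule absolutely_integrable_norm[unfolded o_def])
  have eq: "\<bar>deriv T y\<bar> * ?\<psi> (T y) = cmod (\<phi> y)" if "y \<in> J" for y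
    using transfer_operator_on_branch[OF J that, of \<phi>] supp deriv_nonzero[of y] J that
    by (auto simp: norm_divide)
  have "(\<lambda>y. \<bar>deriv T y\<bar> * ?\<psi> (T y)) absolutely_integrable_on J \<and>
      integral J (\<lambda>y. \<bar>deriv T y\<bar> * ?\<psi> (T y)) = integral J (\<lambda>y. cmod (\<phi> y))"
  proof
    show "(\<lambda>y. \<bar>deriv T y\<bar> * ?\<psi> (T y)) absolutely_integrable_on J"
      using abs by (rule absolutely_integrable_spike[where S = "{}"]) (auto simp: eq)
    show "integral J (\<lambda>y. \<bar>deriv T y\<bar> * ?\<psi> (T y)) = integral J (\<lambda>y. cmod (\<phi> y))"
      by (intro Henstock_Kurzweil_Integration.integral_cong eq)
  qed
  then have TJ_int: "?\<psi> absolutely_integrable_on T ` J" "integral (T ` J) ?\<psi> = integral J (\<lambda>y. cmod (\<phi> y))"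
    using has_absolute_integral_change_of_variables_1'[OF Jm, of T "deriv T" ?\<psi> "integral J (\<lambda>y. cmod (\<phi> y))"]
      has_field_derivative_at_within[OF has_deriv] inj_branch[OF J] J by auto
  have z: "?\<psi> x = 0" if "x \<notin> T ` J" for x
    using that supp by (auto intro!: transfer_operator_off_image)
  have ind: "indicator (T ` J) x *\<^sub>R ?\<psi> x = indicator {0..1} x *\<^sub>R ?\<psi> x" for x
    using z TJ by (auto simp: indicator_def)
  show ?int
    using TJ_int(1) unfolding set_integrable_def ind by (subst integrable_restrict_space) auto
  have "(LINT x|lebesgue_on {0..1}. ?\<psi> x) = (LINT x|lebesgue. indicator {0..1} x *\<^sub>R ?\<psi> x)"
    by (subst integral_restrict_space) auto
  also have "\<dots> = (LINT x:T ` J|lebesgue. ?\<psi> x)"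
    unfolding set_lebesgue_integral_def ind ..
  also have "\<dots> = integral J (\<lambda>y. cmod (\<phi> y))"
    using set_lebesgue_integral_eq_integral(2)[OF TJ_int(1)] TJ_int(2) by simp
  also have "\<dots> = (LINT x:J|lebesgue. cmod (\<phi> x))"
    using set_lebesgue_integral_eq_integral(2)[OF abs] by simp
  also have "\<dots> = (LINT x|lebesgue. indicator {0..1} x *\<^sub>R cmod (\<phi> x))"
    unfolding set_lebesgue_integral_def using supp J01
    by (intro Bochner_Integration.integral_cong) (auto simp: indicator_def)
  also have "\<dots> = (LINT x|lebesgue_on {0..1}. cmod (\<phi> x))"
    by (subst integral_restrict_space) auto
  finally show ?eq .
qed

text \<open>Pigeonhole: by invariance the disjoint preimages of \<open>C\<close> in the branches
  have total length that of \<open>C\<close>, so one of them has at least the average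
  length.\<close>

lemma exists_long_cylinder:
  assumes inv: "lebesgue_invariant \<P> T" and C: "is_interval C" "C \<subseteq> {0..1}"
  shows "\<exists>J\<in>\<P>. measure lborel C / real (card \<P>) \<le> measure lborel {x \<in> J. T x \<in> C}"
proof (rule ccontr)
  assume "\<not> ?thesis"
  then have less: "measure lborel {x \<in> J. T x \<in> C} < measure lborel C / real (card \<P>)" if "J \<in> \<P>" for J
    using that by auto
  have borel: "D \<in> sets borel" if "is_interval D" for D :: "real set"
    using that by (rule real_interval_borel_measurable)
  have card: "card \<P> > 0" using finite_partition partition_nonempty by (simp add: card_gt_0_iff)
  have eq: "T -` C \<inter> \<Union>\<P> = (\<Union>J\<in>\<P>. {x \<in> J. T x \<in> C})" by auto
  have "emeasure lborel (T -` C \<inter> \<Union>\<P>) = emeasure lborel C"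
    using inv C borel[OF C(1)] by (simp add: lebesgue_invariant_def)
  then have "measure lborel C = measure lborel (\<Union>J\<in>\<P>. {x \<in> J. T x \<in> C})"
    unfolding eq by (simp add: measure_def)
  also have "\<dots> = (\<Sum>J\<in>\<P>. measure lborel {x \<in> J. T x \<in> C})"
  proof (rule measure_finite_Union[OF finite_partition])
    show "(\<lambda>J. {x \<in> J. T x \<in> C}) ` \<P> \<subseteq> sets lborel"
      using borel cylinder_interval C(1) by auto
    show "disjoint_family_on (\<lambda>J. {x \<in> J. T x \<in> C}) \<P>"
      using partition_disjoint by (auto simp: disjoint_family_on_def disjoint_def)
    fix J assume J: "J \<in> \<P>"
    then have "{x \<in> J. T x \<in> C} \<subseteq> {0..1}" using partition_subset by auto
    then have "bounded {x \<in> J. T x \<in> C}" using bounded_closed_interval bounded_subset by blast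
    then show "emeasure lborel {x \<in> J. T x \<in> C} \<noteq> \<infinity>" using emeasure_bounded_finite by fastforce
  qed
  also have "\<dots> < real (card \<P>) * (measure lborel C / real (card \<P>))"
    by (rule sum_bounded_above_strict) (use less card in auto)
  finally show False using card by simp
qed

end

section \<open>Transfer operators on Banach spaces embedded in integrable functions\<close>

locale embedded_transfer = piecewise_expanding_map \<P> T
  for \<P> :: "real set set" and T :: "real \<Rightarrow> real" +
  fixes \<iota> :: "'b::complex_banach \<Rightarrow> real \<Rightarrow> complex" and L :: "'b \<Rightarrow> 'b"
  assumes inv: "lebesgue_invariant \<P> T"
    and emb: "continuously_embedded_L1 \<iota>"
    and L_eq: "\<And>f. AE x in lebesgue_on {0..1}. \<iota> (L f) x = transfer_operator \<P> T (\<iota> f) x"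
    and L_bounded: "bounded_linear L"
begin

lemma
  shows \<iota>_integrable: "integrable (lebesgue_on {0..1}) (\<iota> f)"
    and \<iota>_add: "AE x in lebesgue_on {0..1}. \<iota> (f + g) x = \<iota> f x + \<iota> g x"
    and \<iota>_scaleC: "AE x in lebesgue_on {0..1}. \<iota> (c *\<^sub>C f) x = c * \<iota> f x"
    and \<iota>_zero_imp: "(AE x in lebesgue_on {0..1}. \<iota> f x = 0) \<Longrightarrow> f = 0"
  using emb unfolding continuously_embedded_L1_def by blast+

lemma \<iota>_inject:
  assumes "AE x in lebesgue_on {0..1}. \<iota> f x = \<iota> g x"
  shows "f = g"
proof -
  have "AE x in lebesgue_on {0..1}. \<iota> (f + (-1) *\<^sub>C g) x = 0"
    using assms \<iota>_add[of f "(-1) *\<^sub>C g"] \<iota>_scaleC[of "-1" g] by eventually_elim simp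
  then have "f + (-1) *\<^sub>C g = 0" by (rule \<iota>_zero_imp)
  then show ?thesis by (simp add: scaleC.minus_left)
qed

text \<open>Boundedness of \<open>L\<close> gives real linearity only; homogeneity over the complex
  numbers is inherited from the transfer operator by injectivity of \<open>\<iota>\<close> on
  classes.\<close>

lemma L_complex_linear: "complex_linear L"
proof -
  have "L (c *\<^sub>C f) = c *\<^sub>C L f" for c f
  proof (rule \<iota>_inject)
    show "AE x in lebesgue_on {0..1}. \<iota> (L (c *\<^sub>C f)) x = \<iota> (c *\<^sub>C L f) x"
      using L_eq[of "c *\<^sub>C f"] transfer_operator_AE_cong[OF \<iota>_scaleC[of c f]] L_eq[of f] \<iota>_scaleC[of c "L f"]
      by eventually_elim (simp add: transfer_operator_scale)
  qed
  then show ?thesis using L_bounded by (simp add: complex_linear_def)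
qed

lemma \<iota>_sum:
  assumes "finite J"
  shows "AE x in lebesgue_on {0..1}. \<iota> (\<Sum>j\<in>J. c j *\<^sub>C g j) x = (\<Sum>j\<in>J. c j * \<iota> (g j) x)"
  using assms
proof (induction J rule: finite_induct)
  case empty
  show ?case using \<iota>_scaleC[of 0 0] by (simp add: scaleC.zero_left)
next
  case (insert i J)
  show ?case
    using insert.IH \<iota>_add[of "c i *\<^sub>C g i" "\<Sum>j\<in>J. c j *\<^sub>C g j"] \<iota>_scaleC[of "c i" "g i"]
    by eventually_elim (simp add: insert.hyps)
qed

text \<open>The property of a branch domain of \<open>T ^^ n\<close> that the lower bound uses.
  Stated through \<open>L\<close>, it passes from \<open>n\<close> to \<open>n + 1\<close> with the
  change of variables for a single branch.\<close>

definition isometric_on :: "nat \<Rightarrow> real set \<Rightarrow> bool" where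
  "isometric_on n C \<longleftrightarrow> (\<forall>f. (AE x in lebesgue_on {0..1}. x \<notin> C \<longrightarrow> \<iota> f x = 0) \<longrightarrow>
     (LINT x|lebesgue_on {0..1}. cmod (\<iota> ((L ^^ n) f) x)) = (LINT x|lebesgue_on {0..1}. cmod (\<iota> f x)))"

text \<open>One application of \<open>L\<close> preserves the norm, by the isometry on
  \<open>J\<close>, and moves the support into \<open>C\<close>, where the remaining
  \<open>n\<close> applications are isometric.\<close>

lemma isometric_on_Suc:
  assumes J: "J \<in> \<P>" and C: "isometric_on n C" "is_interval C"
  shows "isometric_on (Suc n) {x \<in> J. T x \<in> C}"
  unfolding isometric_on_def
proof (intro allI impI)
  fix f
  let ?D = "{x \<in> J. T x \<in> C}"
  assume f: "AE x in lebesgue_on {0..1}. x \<notin> ?D \<longrightarrow> \<iota> f x = 0"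
  \<comment> \<open>A representative that vanishes at every point outside \<open>?D\<close>, as the
    single-branch isometry requires, and not just almost everywhere.\<close>
  define \<phi> where "\<phi> x = indicator ?D x *\<^sub>R \<iota> f x" for x
  have \<phi>: "AE x in lebesgue_on {0..1}. \<iota> f x = \<phi> x"
    using f by eventually_elim (auto simp: \<phi>_def)
  have D: "?D \<in> sets lebesgue"
    using real_interval_borel_measurable[OF cylinder_interval[OF J C(2)]] by simp
  have "?D \<subseteq> {0..1}" using J partition_subset by auto
  then have "?D \<in> sets (lebesgue_on {0..1})" using D by (simp add: sets_restrict_space_iff)
  then have int: "integrable (lebesgue_on {0..1}) \<phi>"
    unfolding \<phi>_def by (intro integrable_mult_indicator \<iota>_integrable)
  have supp: "\<phi> y = 0" if "y \<notin> J" for y using that by (simp add: \<phi>_def)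
  note iso = transfer_operator_isometry_on_branch[OF J supp int]
  have L\<phi>: "AE x in lebesgue_on {0..1}. \<iota> (L f) x = transfer_operator \<P> T \<phi> x"
    using L_eq[of f] transfer_operator_AE_cong[OF \<phi>] by eventually_elim simp
  have "AE x in lebesgue_on {0..1}. x \<notin> C \<longrightarrow> \<iota> (L f) x = 0"
    using L\<phi>
  proof eventually_elim
    case (elim x)
    show ?case
    proof
      assume "x \<notin> C"
      then have "transfer_operator \<P> T \<phi> x = 0"
        by (intro transfer_operator_off_image) (auto simp: \<phi>_def)
      then show "\<iota> (L f) x = 0" using elim by simp
    qed
  qed
  then have "(LINT x|lebesgue_on {0..1}. cmod (\<iota> ((L ^^ n) (L f)) x))
      = (LINT x|lebesgue_on {0..1}. cmod (\<iota> (L f) x))"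
    using C(1) unfolding isometric_on_def by blast
  also have "\<dots> = (LINT x|lebesgue_on {0..1}. cmod (transfer_operator \<P> T \<phi> x))"
  proof (rule integral_cong_AE)
    show "(\<lambda>x. cmod (\<iota> (L f) x)) \<in> borel_measurable (lebesgue_on {0..1})"
      by (intro borel_measurable_integrable integrable_norm \<iota>_integrable)
    show "(\<lambda>x. cmod (transfer_operator \<P> T \<phi> x)) \<in> borel_measurable (lebesgue_on {0..1})"
      using iso(1) by (rule borel_measurable_integrable)
    show "AE x in lebesgue_on {0..1}. cmod (\<iota> (L f) x) = cmod (transfer_operator \<P> T \<phi> x)"
      using L\<phi> by eventually_elim simp
  qed
  also have "\<dots> = (LINT x|lebesgue_on {0..1}. cmod (\<phi> x))"
    by (rule iso(2))
  also have "\<dots> = (LINT x|lebesgue_on {0..1}. cmod (\<iota> f x))"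
    using \<phi> int \<iota>_integrable[of f]
    by (intro integral_cong_AE borel_measurable_integrable integrable_norm) (auto elim: eventually_mono)
  finally show "(LINT x|lebesgue_on {0..1}. cmod (\<iota> ((L ^^ Suc n) f) x))
      = (LINT x|lebesgue_on {0..1}. cmod (\<iota> f x))"
    by (simp only: funpow_Suc_right o_apply)
qed

text \<open>Start from the unit interval and repeatedly pull back to the longest available cylinder;
  each step costs at most the factor \<open>card \<P>\<close> in length.\<close>

lemma exists_long_isometric_interval:
  "\<exists>C. is_interval C \<and> C \<subseteq> {0..1} \<and> (1 / real (card \<P>)) ^ n \<le> measure lborel C \<and> isometric_on n C"
proof (induction n)
  case 0
  show ?case by (intro exI[of _ "{0..1}"]) (auto simp: isometric_on_def is_interval_cc)
next
  case (Suc n)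
  then obtain C where C: "is_interval C" "C \<subseteq> {0..1}"
    "(1 / real (card \<P>)) ^ n \<le> measure lborel C" "isometric_on n C" by blast
  obtain J where J: "J \<in> \<P>" "measure lborel C / real (card \<P>) \<le> measure lborel {x \<in> J. T x \<in> C}"
    using exists_long_cylinder[OF inv C(1,2)] by blast
  have "(1 / real (card \<P>)) ^ Suc n = (1 / real (card \<P>)) ^ n / real (card \<P>)"
    by simp
  also have "\<dots> \<le> measure lborel C / real (card \<P>)" by (intro divide_right_mono C(3)) simp
  also note J(2)
  finally show ?case
    using cylinder_interval[OF J(1) C(1)] isometric_on_Suc[OF J(1) C(4,1)] J(1) partition_subset
    by (intro exI[of _ "{x \<in> J. T x \<in> C}"]) auto
qed

text \<open>Links decay tested by functionals to decay in \<open>L^1\<close>: integration against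
  the conjugate phase of \<open>h\<close> attains the norm of \<open>h\<close>, and its bound
  \<open>K\<close> does not depend on \<open>h\<close>.\<close>

lemma L1_norm_functional:
  obtains K where "K \<ge> 0"
    "\<And>h. \<exists>l. complex_functional l \<and> (\<forall>g. cmod (l g) \<le> K * norm g) \<and>
       l h = of_real (LINT x|lebesgue_on {0..1}. cmod (\<iota> h x))"
proof -
  let ?M = "lebesgue_on {0..1::real}"
  obtain K0 where K0: "\<And>f. (LINT x|?M. cmod (\<iota> f x)) \<le> K0 * norm f"
    using emb unfolding continuously_embedded_L1_def by (elim conjE exE) auto
  show ?thesis
  \<comment> \<open>The embedding constant carries no sign condition, hence the absolute
    value.\<close>
  proof (rule that[of "\<bar>K0\<bar>"])
    fix h
    \<comment> \<open>Where \<open>\<iota> h\<close> vanishes, \<open>sgn\<close> is 0, so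
      \<open>\<psi>\<close> is bounded by 1 everywhere.\<close>
    define \<psi> where "\<psi> x = cnj (sgn (\<iota> h x))" for x
    define l where "l g = (LINT x|?M. \<psi> x * \<iota> g x)" for g
    have m: "\<psi> \<in> borel_measurable ?M"
    proof -
      have "(\<lambda>x. sgn (\<iota> h x)) \<in> borel_measurable ?M"
        using borel_measurable_integrable[OF \<iota>_integrable[of h]] by measurable
      moreover have "cnj \<in> borel_measurable borel"
        by (intro borel_measurable_continuous_onI continuous_intros)
      ultimately show ?thesis unfolding \<psi>_def by (rule measurable_compose)
    qed
    have \<psi>1: "cmod (\<psi> x) \<le> 1" for x by (simp add: \<psi>_def norm_sgn)
    have int: "integrable ?M (\<lambda>x. \<psi> x * \<iota> g x)" for g
    proof (rule Bochner_Integration.integrable_bound[OF \<iota>_integrable[of g]])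
      show "(\<lambda>x. \<psi> x * \<iota> g x) \<in> borel_measurable ?M"
        using m borel_measurable_integrable[OF \<iota>_integrable[of g]] by (rule borel_measurable_times)
      show "AE x in ?M. cmod (\<psi> x * \<iota> g x) \<le> cmod (\<iota> g x)"
        using \<psi>1 by (simp add: norm_mult mult_left_le_one_le)
    qed
    have mi: "(\<lambda>x. \<psi> x * \<iota> g x) \<in> borel_measurable ?M" for g using int by (rule borel_measurable_integrable)
    have add: "l (f + g) = l f + l g" for f g
    proof -
      have "l (f + g) = (LINT x|?M. \<psi> x * \<iota> f x + \<psi> x * \<iota> g x)"
        unfolding l_def
      proof (rule integral_cong_AE[OF mi])
        show "AE x in ?M. \<psi> x * \<iota> (f + g) x = \<psi> x * \<iota> f x + \<psi> x * \<iota> g x"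
          using \<iota>_add[of f g] by eventually_elim (simp add: distrib_left)
      qed (intro borel_measurable_add mi)
      then show ?thesis by (simp add: l_def int)
    qed
    have scale: "l (c *\<^sub>C f) = c * l f" for c f
    proof -
      have "l (c *\<^sub>C f) = (LINT x|?M. c * (\<psi> x * \<iota> f x))"
        unfolding l_def
      proof (rule integral_cong_AE[OF mi])
        show "AE x in ?M. \<psi> x * \<iota> (c *\<^sub>C f) x = c * (\<psi> x * \<iota> f x)"
          using \<iota>_scaleC[of c f] by eventually_elim simp
      qed (intro borel_measurable_times mi borel_measurable_const)
      then show ?thesis by (simp add: l_def)
    qed
    have bound: "cmod (l g) \<le> \<bar>K0\<bar> * norm g" for g
    proof -
      have "cmod (l g) \<le> (LINT x|?M. cmod (\<psi> x * \<iota> g x))"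
        unfolding l_def by (rule integral_norm_bound)
      also have "\<dots> \<le> (LINT x|?M. cmod (\<iota> g x))"
        using \<psi>1 by (intro integral_mono integrable_norm int \<iota>_integrable) (simp add: norm_mult mult_left_le_one_le)
      also have "\<dots> \<le> \<bar>K0\<bar> * norm g" using K0[of g] by (meson abs_ge_self mult_right_mono norm_ge_zero order.trans)
      finally show ?thesis .
    qed
    have "bounded_linear l"
    proof (rule bounded_linear_intro[OF add])
      show "l (r *\<^sub>R f) = r *\<^sub>R l f" for r f
        using scale[of "complex_of_real r" f] by (simp add: scaleC_of_real scaleR_conv_of_real)
      show "cmod (l g) \<le> norm g * \<bar>K0\<bar>" for g using bound by (simp add: mult.commute)
    qed
    moreover have "l h = of_real (LINT x|?M. cmod (\<iota> h x))"
    proof -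
      have "\<psi> x * \<iota> h x = of_real (cmod (\<iota> h x))" for x
      proof (cases "\<iota> h x = 0")
        case False
        have "cnj (\<iota> h x) * \<iota> h x = of_real (cmod (\<iota> h x)) * of_real (cmod (\<iota> h x))"
          using complex_norm_square[of "\<iota> h x"] by (simp add: mult.commute power2_eq_square)
        then show ?thesis using False by (simp add: \<psi>_def sgn_eq)
      qed (simp add: \<psi>_def)
      then show ?thesis by (simp add: l_def)
    qed
    ultimately show "\<exists>l. complex_functional l \<and> (\<forall>g. cmod (l g) \<le> \<bar>K0\<bar> * norm g) \<and>
       l h = of_real (LINT x|?M. cmod (\<iota> h x))"
      using scale bound by (intro exI[of _ l]) (simp add: complex_functional_def)
  qed simp
qed

section \<open>Combinations of indicators and the lower bound for the radius\<close>

sublocale complex_operator L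
  by unfold_locales (rule L_complex_linear)

text \<open>The vectors \<open>g j\<close> represent indicators of \<open>m\<close> equal pieces of
  a long interval on which \<open>L ^^ n\<close> is isometric. The pieces change with
  \<open>n\<close>, while the upper bound holds with the same \<open>Cst\<close>, because it is
  uniform over all intervals.\<close>

lemma exists_spread_out_combination:
  fixes m :: nat
  assumes Cst: "0 \<le> Cst" "\<And>J. is_interval J \<Longrightarrow> J \<subseteq> {0..1} \<Longrightarrow>
      \<exists>f. (AE x in lebesgue_on {0..1}. \<iota> f x = indicator J x) \<and> norm f \<le> Cst"
    and m: "0 < m"
  obtains g where
    "\<And>c. norm (\<Sum>j<m. c j *\<^sub>C g j) \<le> (\<Sum>j<m. cmod (c j)) * Cst"
    "\<And>c. (1 / real (card \<P>)) ^ n / real m * (\<Sum>j<m. cmod (c j))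
       \<le> (LINT x|lebesgue_on {0..1}. cmod (\<iota> ((L ^^ n) (\<Sum>j<m. c j *\<^sub>C g j)) x))"
proof -
  let ?q = "(1 / real (card \<P>)) ^ n"
  obtain C where C: "is_interval C" "C \<subseteq> {0..1}" "?q \<le> measure lborel C" "isometric_on n C"
    using exists_long_isometric_interval by blast
  have "card \<P> > 0" using finite_partition partition_nonempty by (simp add: card_gt_0_iff)
  then have "0 < ?q" by simp
  then have "0 < measure lborel C" using C(3) by linarith
  then obtain a b where ab: "measure lborel C \<le> b - a" "{a<..<b} \<subseteq> C"
    using interval_contains_open_interval[OF C(1,2)] by blast
  define d where "d = (b - a) / real m"
  have d: "0 < d" "?q / real m \<le> d"
    using ab(1) C(3) \<open>0 < ?q\<close> m by (auto simp: d_def divide_right_mono)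
  \<comment> \<open>Open pieces are disjoint even when adjacent, so the modulus of a combination is
    the combination of the moduli.\<close>
  define I where "I j = {a + real j * d <..< a + (real j + 1) * d}" for j
  have I_sub: "I j \<subseteq> C" if "j < m" for j
  proof -
    have "(real j + 1) * d \<le> real m * d" using that d(1) by (intro mult_right_mono) auto
    also have "\<dots> = b - a" using m by (simp add: d_def)
    finally have "a + (real j + 1) * d \<le> b" by simp
    moreover have "0 \<le> real j * d" using d(1) by simp
    ultimately have "I j \<subseteq> {a<..<b}" by (auto simp: I_def)
    then show ?thesis using ab(2) by blast
  qed
  have disj: "disjoint_family_on I {..<m}"
    unfolding disjoint_family_on_def
  proof (intro ballI impI)
    fix i j :: nat assume "i \<noteq> j"
    have *: "I i \<inter> I j = {}" if "i < j" for i j :: nat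
    proof -
      have "(real i + 1) * d \<le> real j * d" using that d(1) by (intro mult_right_mono) auto
      then show ?thesis by (auto simp: I_def)
    qed
    show "I i \<inter> I j = {}" using *[of i j] *[of j i] \<open>i \<noteq> j\<close> by (cases "i < j") auto
  qed
  have "\<forall>j\<in>{..<m}. \<exists>f. (AE x in lebesgue_on {0..1}. \<iota> f x = indicator (I j) x) \<and> norm f \<le> Cst"
  proof
    fix j assume "j \<in> {..<m}"
    then have "I j \<subseteq> {0..1}" using I_sub[of j] C(2) by auto
    moreover have "is_interval (I j)" by (simp add: I_def is_interval_oo)
    ultimately show "\<exists>f. (AE x in lebesgue_on {0..1}. \<iota> f x = indicator (I j) x) \<and> norm f \<le> Cst"
      using Cst(2) by blast
  qed
  from bchoice[OF this] obtain g where g: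
    "\<And>j. j < m \<Longrightarrow> AE x in lebesgue_on {0..1}. \<iota> (g j) x = indicator (I j) x"
    "\<And>j. j < m \<Longrightarrow> norm (g j) \<le> Cst"
    by auto
  show ?thesis
  proof (rule that[of g])
    fix c :: "nat \<Rightarrow> complex"
    let ?f = "\<Sum>j<m. c j *\<^sub>C g j"
    have "norm ?f \<le> (\<Sum>j<m. cmod (c j) * Cst)"
      by (rule order.trans[OF norm_sum]) (auto simp: norm_scaleC intro!: sum_mono mult_left_mono g(2))
    then show "norm ?f \<le> (\<Sum>j<m. cmod (c j)) * Cst" by (simp add: sum_distrib_right)
    have "AE x in lebesgue_on {0..1}. \<forall>j\<in>{..<m}. \<iota> (g j) x = indicator (I j) x"
      using g(1) by (intro AE_finite_allI) auto
    with \<iota>_sum[OF finite_lessThan, of c g m]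
    have \<iota>f: "AE x in lebesgue_on {0..1}. \<iota> ?f x = (\<Sum>j<m. c j * indicator (I j) x)"
      by eventually_elim simp
    have I_sets: "I j \<in> sets (lebesgue_on {0..1})" and I_meas: "measure (lebesgue_on {0..1}) (I j) = d"
      and I_fin: "emeasure (lebesgue_on {0..1}) (I j) < \<infinity>" if "j < m" for j
    proof -
      have sub: "I j \<subseteq> {0..1}" and leb: "I j \<in> sets lebesgue"
        using I_sub[OF that] C(2) by (auto simp: I_def)
      then show "I j \<in> sets (lebesgue_on {0..1})" by (simp add: sets_restrict_space_iff)
      show "measure (lebesgue_on {0..1}) (I j) = d"
        using sub leb d(1) by (simp add: measure_restrict_space I_def algebra_simps)
      show "emeasure (lebesgue_on {0..1}) (I j) < \<infinity>"
        using sub leb d(1) by (simp add: emeasure_restrict_space I_def algebra_simps)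
    qed
    have "AE x in lebesgue_on {0..1}. x \<notin> C \<longrightarrow> \<iota> ?f x = 0"
      using \<iota>f
    proof eventually_elim
      case (elim x)
      show ?case
      proof
        assume "x \<notin> C"
        then have "(\<Sum>j<m. c j * indicator (I j) x) = 0"
          using I_sub by (intro sum.neutral) (auto simp: indicator_def)
        then show "\<iota> ?f x = 0" using elim by simp
      qed
    qed
    then have "(LINT x|lebesgue_on {0..1}. cmod (\<iota> ((L ^^ n) ?f) x))
        = (LINT x|lebesgue_on {0..1}. cmod (\<iota> ?f x))"
      using C(4) unfolding isometric_on_def by blast
    also have "\<dots> = (LINT x|lebesgue_on {0..1}. (\<Sum>j<m. cmod (c j) * indicator (I j) x))"
    proof (rule integral_cong_AE)
      show "(\<lambda>x. cmod (\<iota> ?f x)) \<in> borel_measurable (lebesgue_on {0..1})"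
        by (intro borel_measurable_integrable integrable_norm \<iota>_integrable)
      show "(\<lambda>x. \<Sum>j<m. cmod (c j) * indicator (I j) x) \<in> borel_measurable (lebesgue_on {0..1})"
        using I_sets by (intro borel_measurable_sum borel_measurable_times borel_measurable_indicator) auto
      show "AE x in lebesgue_on {0..1}. cmod (\<iota> ?f x) = (\<Sum>j<m. cmod (c j) * indicator (I j) x)"
        using \<iota>f by eventually_elim (simp only: disjoint_indicator_sum_norm[OF finite_lessThan disj])
    qed
    also have "\<dots> = (\<Sum>j<m. LINT x|lebesgue_on {0..1}. cmod (c j) * indicator (I j) x)"
      using I_sets I_fin
      by (intro Bochner_Integration.integral_sum integrable_mult_right integrable_real_indicator) auto
    also have "\<dots> = (\<Sum>j<m. cmod (c j) * d)"
      using I_meas I_sets sets.sets_into_space[OF I_sets]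
      by (intro sum.cong) (auto simp: Int_absorb2)
    also have "\<dots> = d * (\<Sum>j<m. cmod (c j))" by (simp add: sum_distrib_left mult.commute)
    finally have eq: "(LINT x|lebesgue_on {0..1}. cmod (\<iota> ((L ^^ n) ?f) x)) = d * (\<Sum>j<m. cmod (c j))" .
    show "?q / real m * (\<Sum>j<m. cmod (c j))
       \<le> (LINT x|lebesgue_on {0..1}. cmod (\<iota> ((L ^^ n) ?f) x))"
      unfolding eq by (intro mult_right_mono d(2) sum_nonneg) simp
  qed
qed

text \<open>The decay rate \<open>\<sigma>\<close> and the codimension bound \<open>N\<close> are
  fixed first; then, for each \<open>n\<close>, vectors adapted to \<open>n\<close> give
  \<open>(?q / \<sigma>) ^ n \<le> B\<close> with \<open>B\<close> independent of \<open>n\<close>,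
  although \<open>?q / \<sigma>\<close> exceeds 1.\<close>

lemma isolated_spectrum_radius_ge:
  assumes Cst: "0 \<le> Cst" "\<And>J. is_interval J \<Longrightarrow> J \<subseteq> {0..1} \<Longrightarrow>
      \<exists>f. (AE x in lebesgue_on {0..1}. \<iota> f x = indicator J x) \<and> norm f \<le> Cst"
    and \<rho>: "0 \<le> \<rho>"
      "\<And>z. z \<in> spectrum L \<Longrightarrow> \<rho> < cmod z \<Longrightarrow> isolated_eigenvalue_of_finite_multiplicity L z"
  shows "1 / real (card \<P>) \<le> \<rho>"
proof (rule ccontr)
  let ?q = "1 / real (card \<P>)"
  assume "\<not> ?q \<le> \<rho>"
  then have "\<rho> < ?q" by simp
  then show False
  proof (rule geometric_decay_on_finite_codimension[OF \<rho>(1) _ \<rho>(2)])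
    fix \<sigma> M N
    assume \<sigma>: "0 < \<sigma>" "\<sigma> < ?q" and M: "M \<ge> 0" and decay:
      "\<And>(J :: nat set) g. finite J \<Longrightarrow> N < card J \<Longrightarrow>
        \<exists>c. (\<exists>j\<in>J. c j \<noteq> 0) \<and> (\<forall>l K n. complex_functional l \<longrightarrow> 0 \<le> K \<longrightarrow> (\<forall>h. cmod (l h) \<le> K * norm h) \<longrightarrow>
          cmod (l ((L ^^ n) (\<Sum>j\<in>J. c j *\<^sub>C g j))) \<le> K * M * norm (\<Sum>j\<in>J. c j *\<^sub>C g j) * \<sigma> ^ Suc n)"
    obtain K where K: "K \<ge> 0"
      "\<And>h. \<exists>l. complex_functional l \<and> (\<forall>g. cmod (l g) \<le> K * norm g) \<and>
         l h = of_real (LINT x|lebesgue_on {0..1}. cmod (\<iota> h x))"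
      using L1_norm_functional by blast
    \<comment> \<open>The factor \<open>Suc N\<close> comes from dividing the long interval, the
      single \<open>\<sigma>\<close> from the exponent \<open>Suc n\<close> in the decay estimate.
      The sum of the moduli of the coefficients cancels.\<close>
    define B where "B = real (Suc N) * (K * M * Cst * \<sigma>)"
    have key: "(?q / \<sigma>) ^ n \<le> B" for n
    proof -
      obtain g where g:
        "\<And>c. norm (\<Sum>j<Suc N. c j *\<^sub>C g j) \<le> (\<Sum>j<Suc N. cmod (c j)) * Cst"
        "\<And>c. ?q ^ n / real (Suc N) * (\<Sum>j<Suc N. cmod (c j))
           \<le> (LINT x|lebesgue_on {0..1}. cmod (\<iota> ((L ^^ n) (\<Sum>j<Suc N. c j *\<^sub>C g j)) x))"
        using exists_spread_out_combination[OF Cst zero_less_Suc, of N n] by blast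
      obtain c where c: "\<exists>j\<in>{..<Suc N}. c j \<noteq> 0"
        "\<forall>l K n. complex_functional l \<longrightarrow> 0 \<le> K \<longrightarrow> (\<forall>h. cmod (l h) \<le> K * norm h) \<longrightarrow>
          cmod (l ((L ^^ n) (\<Sum>j<Suc N. c j *\<^sub>C g j))) \<le> K * M * norm (\<Sum>j<Suc N. c j *\<^sub>C g j) * \<sigma> ^ Suc n"
        using decay[of "{..<Suc N}" g] by (auto simp del: sum.lessThan_Suc power_Suc)
      define f where "f = (\<Sum>j<Suc N. c j *\<^sub>C g j)"
      define s where "s = (\<Sum>j<Suc N. cmod (c j))"
      have "s \<noteq> 0" unfolding s_def using c(1) by (subst sum_nonneg_eq_0_iff) auto
      moreover have "0 \<le> s" unfolding s_def by (intro sum_nonneg) simp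
      ultimately have s: "s > 0" by simp
      obtain l where l: "complex_functional l" "\<forall>g. cmod (l g) \<le> K * norm g"
         "l ((L ^^ n) f) = of_real (LINT x|lebesgue_on {0..1}. cmod (\<iota> ((L ^^ n) f) x))"
        using K(2) by blast
      have "?q ^ n / real (Suc N) * s \<le> (LINT x|lebesgue_on {0..1}. cmod (\<iota> ((L ^^ n) f) x))"
        using g(2)[of c] by (simp only: s_def f_def)
      also have "\<dots> \<le> cmod (l ((L ^^ n) f))" by (simp add: l(3))
      also have "\<dots> \<le> K * M * norm f * \<sigma> ^ Suc n"
        using c(2)[rule_format, OF l(1) K(1)] l(2) unfolding f_def by simp
      also have "\<dots> \<le> K * M * (s * Cst) * \<sigma> ^ Suc n"
        using g(1)[of c] K(1) M \<sigma>(1) unfolding f_def s_def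
        by (intro mult_right_mono mult_left_mono) auto
      finally have "?q ^ n / real (Suc N) * s \<le> (K * M * Cst * \<sigma> ^ Suc n) * s"
        by (simp only: mult_ac)
      then have "?q ^ n / real (Suc N) \<le> K * M * Cst * \<sigma> ^ Suc n"
        using s by (simp only: mult_le_cancel_right_pos)
      then have "?q ^ n \<le> B * \<sigma> ^ n"
        by (simp add: B_def divide_le_eq mult_ac)
      then have "?q ^ n / \<sigma> ^ n \<le> B"
        using pos_divide_le_eq[of "\<sigma> ^ n" "?q ^ n" B] \<sigma>(1) by simp
      then show ?thesis by (simp only: power_divide[of ?q \<sigma> n])
    qed
    have "1 < ?q / \<sigma>" using \<sigma> by (simp only: less_divide_eq_1_pos)
    then obtain n where "B < (?q / \<sigma>) ^ n" using real_arch_pow by blast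
    then show False using key[of n] by simp
  qed
qed

end

section \<open>From the hypotheses on the map to the abstract setting\<close>

lemma piecewise_onto_has_derivative:
  assumes "r > 0" "interval_partition \<P>" "piecewise_onto (r + 1) \<P> T" "J \<in> \<P>"
  shows "inj_on T J" and "x \<in> J \<Longrightarrow> (T has_real_derivative deriv T x) (at x)"
proof -
  obtain g where g: "\<And>x. x \<in> J \<Longrightarrow> g x = T x" "C_diffeo (r + 1) g (closure J) {0..1}"
    using assms(3,4) unfolding piecewise_onto_def by blast
  have "inj_on g J"
    using g(2) closure_subset unfolding C_diffeo_def bij_betw_def by (meson inj_on_subset)
  then show "inj_on T J" using g(1) by (simp cong: inj_on_cong)
  assume x: "x \<in> J"
  have op: "open J" using assms(2,4) by (auto simp: interval_partition_def)
  \<comment> \<open>Positivity of \<open>r\<close> guarantees at least one derivative in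
    \<open>C_class\<close>. It is taken within the closed branch, and becomes a two-sided derivative
    on the open interval \<open>J\<close>.\<close>
  have "0 < nat \<lfloor>r + 1\<rfloor>" using assms(1) by (simp add: floor_less_iff)
  from g(2) have "C_class (r + 1) (closure J) g" by (simp add: C_diffeo_def)
  then obtain D where D: "\<forall>x\<in>closure J. D 0 x = g x"
    "\<forall>j<nat \<lfloor>r + 1\<rfloor>. \<forall>x\<in>closure J. (D j has_real_derivative D (Suc j) x) (at x within closure J)"
    unfolding C_class_def by (elim exE conjE) (rule that)
  then have D1: "(D 0 has_real_derivative D (Suc 0) x) (at x within closure J)"
    using x closure_subset \<open>0 < nat \<lfloor>r + 1\<rfloor>\<close> by blast
  have "(D 0 has_real_derivative D (Suc 0) x) (at x within J)"
    using D1 closure_subset by (rule has_field_derivative_subset)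
  then have "(D 0 has_real_derivative D (Suc 0) x) (at x)" using at_within_open[OF x op] by simp
  then have "(T has_real_derivative D (Suc 0) x) (at x)"
  proof (rule has_field_derivative_transform_within_open[OF _ op x])
    fix y assume "y \<in> J"
    then show "D 0 y = T y" using D(1) g(1)[of y] closure_subset[of J] by auto
  qed
  then show "(T has_real_derivative deriv T x) (at x)" by (simp add: DERIV_imp_deriv)
qed

theorem theorem3:
  fixes \<P> :: "real set set" and T :: "real \<Rightarrow> real" and r :: real and k :: nat
    and \<iota> :: "'b::complex_banach \<Rightarrow> real \<Rightarrow> complex" and L :: "'b \<Rightarrow> 'b"
  assumes "interval_partition \<P>"
    and "T \<in> \<Union>\<P> \<rightarrow> {0..1}"
    and "lebesgue_invariant \<P> T"
    and "r > 0"
    and "piecewise_onto (r + 1) \<P> T"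
    and "expanding \<P> T"
    and "card \<P> = k"
    and "exp (top_pressure \<P> T (\<lambda>x. - (r + 1) * ln \<bar>deriv T x\<bar>)) < 1 / real k"
    and "continuously_embedded_L1 \<iota>"
    and "\<And>f. AE x in lebesgue_on {0..1}. \<iota> (L f) x = transfer_operator \<P> T (\<iota> f) x"
    and "bounded_linear L"
    and "\<exists>C\<ge>0. \<forall>J. is_interval J \<and> J \<subseteq> {0..1} \<longrightarrow>
           (\<exists>f. (AE x in lebesgue_on {0..1}. \<iota> f x = indicator J x) \<and> norm f \<le> C)"
  shows "ess_spectral_radius L \<ge> 1 / real k"
proof -
  note branch = piecewise_onto_has_derivative[OF assms(4,1,5)]
  obtain \<Lambda> where \<Lambda>: "\<Lambda> > 1" "\<And>x. x \<in> \<Union>\<P> \<Longrightarrow> \<Lambda> \<le> \<bar>deriv T x\<bar>"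
    using assms(6) unfolding expanding_def by blast
  interpret embedded_transfer \<P> T \<iota> L
  proof (intro embedded_transfer.intro piecewise_expanding_map.intro embedded_transfer_axioms.intro)
    show "(T has_real_derivative deriv T x) (at x)" if "x \<in> \<Union>\<P>" for x
      using branch(2) that by blast
    show "deriv T x \<noteq> 0" if "x \<in> \<Union>\<P>" for x using \<Lambda>(1) \<Lambda>(2)[OF that] by auto
  qed (use assms branch(1) in auto)
  obtain Cst where Cst: "0 \<le> Cst" "\<And>J. is_interval J \<Longrightarrow> J \<subseteq> {0..1} \<Longrightarrow>
      \<exists>f. (AE x in lebesgue_on {0..1}. \<iota> f x = indicator J x) \<and> norm f \<le> Cst"
    using assms(12) by blast
  show ?thesis
    unfolding ess_spectral_radius_def
  proof (rule cInf_greatest)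
    \<comment> \<open>The set under the infimum must be nonempty; \<open>onorm L\<close> belongs to
      it vacuously, as no spectrum lies beyond it.\<close>
    have "onorm L \<in> {\<rho>. 0 \<le> \<rho> \<and>
       (\<forall>z\<in>spectrum L. cmod z > \<rho> \<longrightarrow> isolated_eigenvalue_of_finite_multiplicity L z)}"
      using outside_norm_not_in_spectrum onorm_pos_le[OF assms(11)] by blast
    then show "{\<rho>. 0 \<le> \<rho> \<and>
       (\<forall>z\<in>spectrum L. cmod z > \<rho> \<longrightarrow> isolated_eigenvalue_of_finite_multiplicity L z)} \<noteq> {}"
      by blast
  next
    fix \<rho> assume "\<rho> \<in> {\<rho>. 0 \<le> \<rho> \<and>
       (\<forall>z\<in>spectrum L. cmod z > \<rho> \<longrightarrow> isolated_eigenvalue_of_finite_multiplicity L z)}"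
    then have "0 \<le> \<rho>" "\<And>z. z \<in> spectrum L \<Longrightarrow> \<rho> < cmod z \<Longrightarrow>
        isolated_eigenvalue_of_finite_multiplicity L z" by auto
    from isolated_spectrum_radius_ge[OF Cst this] show "1 / real k \<le> \<rho>"
      using assms(7) by simp
  qed
qed

end
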